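(* Let $d\ge 1$, let $A,B$ be finite alphabets, let $p$ be a probability vector on $A$ and $q$ a probability vector on $B$, and let $X\sim\mu=p^{\mathbb{Z}^d}$ and $Y\sim\nu=q^{\mathbb{Z}^d}$ be the corresponding i.i.d. $\mathbb{Z}^d$-processes. Assume $X$ and $Y$ have equal entropy, $h(p)=h(q)$. If there exists a finitary homomorphism $\phi:X\to Y$ whose coding radius satisfies $\mathbf{E}[R_\phi^{d/2}]<\infty$, then $\mathrm{Var}(I_p(X_0))=\mathrm{Var}(I_q(Y_0))$, i.e. $\mathrm{Var}(\log p(X_0))=\mathrm{Var}(\log q(Y_0))$.
   Context: For a finite probability vector $p$ on $A$, the entropy is $h(p)=-\sum_{a\in A}p_a\log p_a$ and the information function is $I_p(a)=\log p_a^{-1}$. A homomorphism (factor map) $\phi:X\to Y$ is a measurable map $\phi:A^{\mathbb{Z}^d}\to B^{\mathbb{Z}^d}$, defined $\mu$-a.e., that commutes with the $\mathbb{Z}^d$-shifts ($\phi(T_{u}x)=T_u\phi(x)$, where $(T_{-u}x)_v=x_{v+u}$) and satisfies $\phi_*\mu=\nu$. With $B(0,n)=[-n,n]^d\subset\mathbb{Z}^d$, the coding radius of $\phi$ is the random variable $R_\phi(x)=\min\{n\in\mathbb{N}\cup\{\infty\}: \text{for }\mu\text{-a.e. } a,\ (a_i)_{i\in B(0,n)}=(x_i)_{i\in B(0,n)}\Rightarrow \phi(a)_0=\phi(x)_0\}$. The map $\phi$ is finitary if $R_\phi<\infty$ $\mu$-a.s. *)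

theory Defs
  imports "HOL-Probability.Probability"
begin

text \<open>Lattice points of Z^d are vectors int^'d with 'd a finite type, d = CARD('d) \<ge> 1.
  Configurations are maps from lattice points to the alphabet.\<close>

definition iid_measure :: "'a pmf \<Rightarrow> (int^'d \<Rightarrow> 'a) measure" where
  "iid_measure p = PiM UNIV (\<lambda>_. measure_pmf p)"

definition entropy_pv :: "'a::finite pmf \<Rightarrow> real" where
  "entropy_pv p = - (\<Sum>a\<in>UNIV. pmf p a * ln (pmf p a))"

definition info_fun :: "'a pmf \<Rightarrow> 'a \<Rightarrow> real" where
  "info_fun p a = ln (1 / pmf p a)"

definition shift :: "int^'d \<Rightarrow> (int^'d \<Rightarrow> 'a) \<Rightarrow> (int^'d \<Rightarrow> 'a)" where
  "shift u x = (\<lambda>v. x (v - u))"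

definition is_homomorphism ::
  "(int^'d \<Rightarrow> 'a) measure \<Rightarrow> (int^'d \<Rightarrow> 'b) measure
     \<Rightarrow> ((int^'d \<Rightarrow> 'a) \<Rightarrow> (int^'d \<Rightarrow> 'b)) \<Rightarrow> bool" where
  "is_homomorphism \<mu> \<nu> \<phi> \<longleftrightarrow>
     \<phi> \<in> measurable \<mu> \<nu> \<and>
     (AE x in \<mu>. \<forall>u. \<phi> (shift u x) = shift u (\<phi> x)) \<and>
     distr \<mu> \<nu> \<phi> = \<nu>"

definition box :: "nat \<Rightarrow> (int^'d) set" where
  "box n = {v. \<forall>i. \<bar>v $ i\<bar> \<le> int n}"

definition coding_radius ::
  "(int^'d \<Rightarrow> 'a) measure \<Rightarrow> ((int^'d \<Rightarrow> 'a) \<Rightarrow> (int^'d \<Rightarrow> 'b))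
     \<Rightarrow> (int^'d \<Rightarrow> 'a) \<Rightarrow> enat" where
  "coding_radius \<mu> \<phi> x =
     (let P = (\<lambda>n::nat. AE a in \<mu>. (\<forall>i\<in>box n. a i = x i) \<longrightarrow> \<phi> a 0 = \<phi> x 0)
      in if \<exists>n. P n then enat (LEAST n. P n) else \<infinity>)"

definition finitary :: "(int^'d \<Rightarrow> 'a) measure \<Rightarrow> ((int^'d \<Rightarrow> 'a) \<Rightarrow> (int^'d \<Rightarrow> 'b)) \<Rightarrow> bool" where
  "finitary \<mu> \<phi> \<longleftrightarrow> (AE x in \<mu>. coding_radius \<mu> \<phi> x < \<infinity>)"

end

theory Submission
  imports Defs "HOL-Real_Asymp.Real_Asymp"
begin

text \<open>
  Write \<open>Y = \<phi> X\<close>. If the pattern of \<open>X\<close> on a finite set \<open>L\<close> determines \<open>Y\<close> on \<open>K\<close>, then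
  \<open>p(X\<^sub>L) \<le> q(Y\<^sub>K)\<close>; hence, almost surely, the information of \<open>Y\<close> on the sites determined by
  \<open>X\<^sub>L\<close> is at most that of \<open>X\<close> on \<open>L\<close>. For \<open>d \<ge> 2\<close> the boundary of \<open>L\<close> alone spoils this bound on the
  scale \<open>|L|\<^bsup>1/2\<^esup>\<close> of the central limit theorem. Being pointwise, however, the inequality may be
  integrated against any density. Tile space by cubes of side \<open>l\<close>, each containing a concentric
  smaller cube, and use the density \<open>\<Prod>\<^sub>i (1 + \<psi>\<^sub>i)\<close> with \<open>\<psi>\<^sub>i\<close> a centred function, bounded by 1, of
  \<open>X\<close> on the \<open>i\<close>-th smaller cube. Letting the number of tiles tend to infinity removes the boundary
  term, and within each tile only its own factor is felt. Thus, if \<open>D\<close> denotes the difference of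
  the informations of \<open>Y\<close> and \<open>X\<close> on a tile \<open>K\<close>, then \<open>E[\<psi> D]\<close> is at most a constant times
  \<open>|K| P(R > n)\<close>. Taking for \<open>\<psi>\<close> the centred sign of a local version of \<open>D\<close> bounds \<open>E|D|\<close>; since the
  moment hypothesis gives \<open>P(R > n) = o(n\<^bsup>-d/2\<^esup>)\<close>, it follows that \<open>E|D| = o(|K|\<^bsup>1/2\<^esup>)\<close> for \<open>l\<close> a
  large multiple of \<open>n\<close>. So the informations of \<open>X\<close> and \<open>Y\<close> on \<open>K\<close>, centred and divided by
  \<open>|K|\<^bsup>1/2\<^esup>\<close>, have the same Gaussian limit, whose characteristic function at 1 is \<open>e\<^bsup>-v/2\<^esup>\<close> with \<open>v\<close>
  the variance of either information function.
\<close>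

subsection \<open>Real random variables\<close>

lemma abs_le_sgn_mult_add:
  fixes d w :: real
  shows "\<bar>d\<bar> \<le> sgn w * d + 2 * \<bar>d - w\<bar>"
  by (auto simp: sgn_if abs_if)

context prob_space
begin

lemma expectation_abs_le_sqrt:
  fixes X :: "'a \<Rightarrow> real"
  assumes "integrable M X" "integrable M (\<lambda>x. (X x)\<^sup>2)"
  shows "expectation (\<lambda>x. \<bar>X x\<bar>) \<le> sqrt (expectation (\<lambda>x. (X x)\<^sup>2))"
proof (rule real_le_rsqrt)
  have "0 \<le> variance (\<lambda>x. \<bar>X x\<bar>)"
    by (rule variance_positive)
  also have "\<dots> = expectation (\<lambda>x. \<bar>X x\<bar>\<^sup>2) - (expectation (\<lambda>x. \<bar>X x\<bar>))\<^sup>2"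
    using assms by (intro variance_eq) auto
  finally show "(expectation (\<lambda>x. \<bar>X x\<bar>))\<^sup>2 \<le> expectation (\<lambda>x. (X x)\<^sup>2)"
    by simp
qed

lemma variance_sum_indep:
  fixes X :: "'i \<Rightarrow> 'a \<Rightarrow> real"
  assumes finite_I: "finite I" and indep: "indep_vars (\<lambda>_. borel) X I"
    and int_sq: "\<And>i. i \<in> I \<Longrightarrow> integrable M (\<lambda>x. (X i x)\<^sup>2)"
  shows "variance (\<lambda>x. \<Sum>i\<in>I. X i x) = (\<Sum>i\<in>I. variance (X i))"
proof -
  define Y where "Y i x = X i x - expectation (X i)" for i x
  have int_X: "integrable M (X i)" if "i \<in> I" for i
    using indep that by (intro square_integrable_imp_integrable[OF _ int_sq]) (simp_all add: indep_vars_def2)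
  have int_Y: "integrable M (Y i)" and int_sq_Y: "integrable M (\<lambda>x. (Y i x)\<^sup>2)"
    and mean_Y: "expectation (Y i) = 0" if "i \<in> I" for i
    using int_X[OF that] int_sq[OF that] by (auto simp: Y_def[abs_def] power2_diff prob_space)
  have "indep_vars (\<lambda>_. borel) Y I"
    unfolding Y_def[abs_def] by (rule indep_vars_compose2[OF indep]) auto
  then have indep_Y: "indep_var borel (Y i) borel (Y j)" if "i \<in> I" "j \<in> I" "i \<noteq> j" for i j
    using indep_vars_sum[of "{j}" i Y] that by (auto intro: indep_vars_subset)
  have int_mult: "integrable M (\<lambda>x. Y i x * Y j x)" if "i \<in> I" "j \<in> I" for i j
    using indep_var_integrable[OF indep_Y] that int_Y int_sq_Y by (cases "i = j") (auto simp: power2_eq_square)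
  have covariance: "expectation (\<lambda>x. Y i x * Y j x) = (if i = j then variance (X i) else 0)"
    if "i \<in> I" "j \<in> I" for i j
  proof (cases "i = j")
    case True
    then show ?thesis
      by (simp add: power2_eq_square Y_def)
  next
    case False
    then show ?thesis
      using indep_var_lebesgue_integral[OF indep_Y int_Y int_Y, of i j] mean_Y that by simp
  qed
  have "variance (\<lambda>x. \<Sum>i\<in>I. X i x) = expectation (\<lambda>x. (\<Sum>i\<in>I. Y i x)\<^sup>2)"
    using int_X by (simp add: Y_def sum_subtractf)
  also have "\<dots> = (\<Sum>i\<in>I. \<Sum>j\<in>I. expectation (\<lambda>x. Y i x * Y j x))"
    using int_mult by (simp add: power2_eq_square sum_product)
  also have "\<dots> = (\<Sum>i\<in>I. variance (X i))"
    using finite_I by (simp add: covariance)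
  finally show ?thesis .
qed

lemma tendsto_mult_prob_ge_0:
  fixes f :: "'a \<Rightarrow> real"
  assumes int: "integrable M f" and c_at_top: "filterlim c at_top sequentially" and c_nonneg: "\<And>n. 0 \<le> c n"
  shows "(\<lambda>n. c n * prob {x\<in>space M. c n \<le> f x}) \<longlonglongrightarrow> 0"
proof -
  note [measurable] = borel_measurable_integrable[OF int]
  let ?A = "\<lambda>n. {x\<in>space M. c n \<le> f x}"
  have "(\<lambda>n. expectation (\<lambda>x. c n * indicator (?A n) x)) \<longlonglongrightarrow> expectation (\<lambda>x. 0)"
  proof (rule integral_dominated_convergence[OF _ _ integrable_abs[OF int]])
    show "AE x in M. (\<lambda>n. c n * indicator (?A n) x) \<longlonglongrightarrow> 0"
    proof (intro AE_I2 tendsto_eventually)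
      fix x
      have "\<forall>\<^sub>F n in sequentially. f x < c n"
        using c_at_top by (simp add: filterlim_at_top_dense)
      then show "\<forall>\<^sub>F n in sequentially. c n * indicator (?A n) x = 0"
        by eventually_elim auto
    qed
    show "AE x in M. norm (c n * indicator (?A n) x) \<le> \<bar>f x\<bar>" for n
      using c_nonneg[of n] by (intro AE_I2) (auto simp: indicator_def)
  qed auto
  then show ?thesis
    by (simp add: Collect_conj_eq Int_absorb1)
qed

lemma cmod_char_distr_diff_le:
  fixes X Y :: "'a \<Rightarrow> real"
  assumes int_X: "integrable M X" and int_Y: "integrable M Y"
  shows "cmod (char (distr M borel X) t - char (distr M borel Y) t) \<le> \<bar>t\<bar> * expectation (\<lambda>x. \<bar>X x - Y x\<bar>)"
proof -
  note [measurable] = borel_measurable_integrable[OF int_X] borel_measurable_integrable[OF int_Y]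
  have lipschitz: "cmod (iexp a - iexp b) \<le> \<bar>a - b\<bar>" for a b :: real
  proof -
    have "iexp a - iexp b = iexp b * (iexp (a - b) - 1)"
      by (simp add: right_diff_distrib exp_add[symmetric])
    then have "cmod (iexp a - iexp b) = cmod (iexp (a - b) - 1)"
      by (simp add: norm_mult)
    also have "\<dots> \<le> \<bar>a - b\<bar>"
      using iexp_approx1[of "a - b" 0] by simp
    finally show ?thesis .
  qed
  have int_iexp: "integrable M (\<lambda>x. iexp (t * Z x))" if [measurable]: "random_variable borel Z" for Z
    using integrable_iexp[of "\<lambda>x. complex_of_real (t * Z x)"] by simp
  have "cmod (char (distr M borel X) t - char (distr M borel Y) t)
      = cmod (CLINT x|M. iexp (t * X x) - iexp (t * Y x))"
    using int_iexp[of X] int_iexp[of Y] by (simp add: char_def integral_distr)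
  also have "\<dots> \<le> expectation (\<lambda>x. cmod (iexp (t * X x) - iexp (t * Y x)))"
    by (rule integral_norm_bound)
  also have "\<dots> \<le> expectation (\<lambda>x. \<bar>t\<bar> * \<bar>X x - Y x\<bar>)"
    using int_X int_Y int_iexp[of X] int_iexp[of Y] lipschitz
    by (intro integral_mono) (auto simp: abs_mult[symmetric] right_diff_distrib simp del: of_real_mult)
  finally show ?thesis
    by simp
qed

definition centred_sgn :: "('a \<Rightarrow> real) \<Rightarrow> 'a \<Rightarrow> real" where
  "centred_sgn W x = (sgn (W x) - expectation (\<lambda>x. sgn (W x))) / 2"

lemma integrable_sgn:
  fixes W :: "'a \<Rightarrow> real"
  shows "random_variable borel W \<Longrightarrow> integrable M (\<lambda>x. sgn (W x))"
  by (rule integrable_const_bound[of _ 1]) (auto simp: abs_sgn_eq)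

lemma expectation_centred_sgn: "random_variable borel W \<Longrightarrow> expectation (centred_sgn W) = 0"
  using integrable_sgn[of W] by (simp add: centred_sgn_def[abs_def] prob_space)

lemma abs_centred_sgn_le_1:
  assumes "random_variable borel W"
  shows "\<bar>centred_sgn W x\<bar> \<le> 1"
proof -
  have "\<bar>expectation (\<lambda>x. sgn (W x))\<bar> \<le> expectation (\<lambda>x. \<bar>sgn (W x)\<bar>)"
    by (rule integral_abs_bound)
  also have "\<dots> \<le> 1"
    by (intro integral_le_const integrable_abs integrable_sgn assms) (simp add: abs_sgn_eq)
  finally show ?thesis
    by (auto simp: centred_sgn_def sgn_if)
qed

lemma expectation_abs_le_centred_sgn:
  fixes D W :: "'a \<Rightarrow> real"
  assumes int_D: "integrable M D" and mean_D: "expectation D = 0" and int_W: "integrable M W"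
  shows "expectation (\<lambda>x. \<bar>D x\<bar>)
    \<le> 2 * expectation (\<lambda>x. centred_sgn W x * D x) + 2 * expectation (\<lambda>x. \<bar>D x - W x\<bar>)"
proof -
  note [measurable] = borel_measurable_integrable[OF int_W] borel_measurable_integrable[OF int_D]
  have int_mult: "integrable M (\<lambda>x. sgn (W x) * D x)"
    by (rule Bochner_Integration.integrable_bound[OF int_D]) (auto simp: abs_mult sgn_if)
  have "expectation (\<lambda>x. \<bar>D x\<bar>) \<le> expectation (\<lambda>x. sgn (W x) * D x + 2 * \<bar>D x - W x\<bar>)"
    using int_D int_W int_mult by (intro integral_mono abs_le_sgn_mult_add) auto
  also have "\<dots> = expectation (\<lambda>x. sgn (W x) * D x) + 2 * expectation (\<lambda>x. \<bar>D x - W x\<bar>)"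
    using int_D int_W int_mult by simp
  also have "expectation (\<lambda>x. sgn (W x) * D x) = 2 * expectation (\<lambda>x. centred_sgn W x * D x)"
    using int_D mean_D int_mult by (simp add: centred_sgn_def left_diff_distrib)
  finally show ?thesis .
qed

end

text \<open>The expectation is the one in the remainder of \<open>char_approx3\<close>.\<close>
lemma (in real_distribution) expectation_min_cubic_tendsto_0:
  assumes int: "integrable M (\<lambda>x. x\<^sup>2)" and s_null: "s \<longlonglongrightarrow> 0"
  shows "(\<lambda>n. expectation (\<lambda>x. min (6 * x\<^sup>2) (\<bar>s n\<bar> * \<bar>x\<bar> ^ 3))) \<longlonglongrightarrow> 0"
proof -
  have "(\<lambda>n. expectation (\<lambda>x. min (6 * x\<^sup>2) (\<bar>s n\<bar> * \<bar>x\<bar> ^ 3))) \<longlonglongrightarrow> expectation (\<lambda>x. 0)"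
  proof (rule integral_dominated_convergence[where w = "\<lambda>x. 6 * x\<^sup>2"])
    have "(\<lambda>n. min (6 * x\<^sup>2) (\<bar>s n\<bar> * \<bar>x\<bar> ^ 3)) \<longlonglongrightarrow> min (6 * x\<^sup>2) (\<bar>0\<bar> * \<bar>x\<bar> ^ 3)" for x :: real
      by (intro tendsto_intros s_null)
    then show "AE x in M. (\<lambda>n. min (6 * x\<^sup>2) (\<bar>s n\<bar> * \<bar>x\<bar> ^ 3)) \<longlonglongrightarrow> 0"
      by simp
    show "AE x in M. norm (min (6 * x\<^sup>2) (\<bar>s n\<bar> * \<bar>x\<bar> ^ 3)) \<le> 6 * x\<^sup>2" for n
      by (simp add: abs_of_nonneg)
  qed (use int in simp_all)
  then show ?thesis
    by simp
qed

lemma (in real_distribution) char_power_tendsto_exp: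
  assumes int: "integrable M (\<lambda>x. x)" and int_sq: "integrable M (\<lambda>x. x\<^sup>2)" and mean: "expectation (\<lambda>x. x) = 0"
  shows "(\<lambda>n. char M (t / sqrt (real n)) ^ n)
    \<longlonglongrightarrow> complex_of_real (exp (- (t\<^sup>2 * variance (\<lambda>x. x) / 2)))"
proof -
  let ?s = "\<lambda>n. t / sqrt (real n)" and ?v = "variance (\<lambda>x. x)"
  define \<rho> where "\<rho> n = expectation (\<lambda>x. min (6 * x\<^sup>2) (\<bar>?s n\<bar> * \<bar>x\<bar> ^ 3))" for n
  let ?w = "\<lambda>n. 1 + - (t\<^sup>2 * ?v / 2) / real n"
  have close: "cmod (char M (?s n) ^ n - of_real (?w n ^ n)) \<le> t\<^sup>2 / 6 * \<rho> n"
    if n_large: "t\<^sup>2 * ?v / 4 \<le> real n" and "0 < n" for n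
  proof -
    have "cmod (char M (?s n) - of_real (?w n)) \<le> (?s n)\<^sup>2 / 6 * \<rho> n"
      using char_approx3[OF int mean int_sq refl, of "?s n"]
      by (simp add: power_divide \<rho>_def mult.commute[of 2])
    moreover have "\<bar>?w n\<bar> \<le> 1"
      using n_large \<open>0 < n\<close> variance_positive[of "\<lambda>x. x"] by (simp add: abs_le_iff field_simps)
    then have "cmod (of_real (?w n)) \<le> 1"
      by (simp only: norm_of_real)
    ultimately have "cmod (char M (?s n) ^ n - of_real (?w n ^ n)) \<le> real n * ((?s n)\<^sup>2 / 6 * \<rho> n)"
      unfolding of_real_power
      by (intro order_trans[OF norm_power_diff] mult_left_mono cmod_char_le_1) auto
    then show ?thesis
      using \<open>0 < n\<close> by (simp add: power_divide)
  qed
  have "?s \<longlonglongrightarrow> 0"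
    by real_asymp
  then have "(\<lambda>n. t\<^sup>2 / 6 * \<rho> n) \<longlonglongrightarrow> 0"
    unfolding \<rho>_def by (intro tendsto_mult_right_zero expectation_min_cubic_tendsto_0 int_sq)
  moreover have "\<forall>\<^sub>F n in sequentially. cmod (char M (?s n) ^ n - of_real (?w n ^ n)) \<le> t\<^sup>2 / 6 * \<rho> n"
    using eventually_gt_at_top[of 0] filterlim_real_sequentially[unfolded filterlim_at_top, rule_format]
    by eventually_elim (rule close)
  ultimately have "(\<lambda>n. char M (?s n) ^ n - of_real (?w n ^ n)) \<longlonglongrightarrow> 0"
    by (rule Lim_null_comparison[rotated])
  moreover have "(\<lambda>n. complex_of_real (?w n ^ n)) \<longlonglongrightarrow> of_real (exp (- (t\<^sup>2 * ?v / 2)))"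
    by (intro tendsto_of_real tendsto_exp_limit_sequentially)
  ultimately show ?thesis
    by (rule Lim_transform[rotated])
qed

subsection \<open>Functions of finitely many coordinates\<close>

definition depends_on :: "'i set \<Rightarrow> (('i \<Rightarrow> 'a) \<Rightarrow> 'c) \<Rightarrow> bool" where
  "depends_on A F \<longleftrightarrow> (\<forall>x y. (\<forall>i\<in>A. x i = y i) \<longrightarrow> F x = F y)"

lemma depends_onI: "(\<And>x y. (\<And>i. i \<in> A \<Longrightarrow> x i = y i) \<Longrightarrow> F x = F y) \<Longrightarrow> depends_on A F"
  unfolding depends_on_def by blast

lemma depends_onD: "depends_on A F \<Longrightarrow> (\<And>i. i \<in> A \<Longrightarrow> x i = y i) \<Longrightarrow> F x = F y"
  unfolding depends_on_def by blast

lemma depends_on_mono: "depends_on A F \<Longrightarrow> A \<subseteq> B \<Longrightarrow> depends_on B F"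
  unfolding depends_on_def by blast

lemma depends_on_component: "v \<in> A \<Longrightarrow> depends_on A (\<lambda>x. g (x v))"
  unfolding depends_on_def by simp

lemma depends_on_compose: "depends_on A F \<Longrightarrow> depends_on A (\<lambda>x. g (F x))"
  unfolding depends_on_def by fastforce

lemma depends_on_compose2:
  "depends_on A F \<Longrightarrow> depends_on A G \<Longrightarrow> depends_on A (\<lambda>x. g (F x) (G x))"
  unfolding depends_on_def by fastforce

lemma depends_on_sum:
  "(\<And>v. v \<in> S \<Longrightarrow> depends_on A (F v)) \<Longrightarrow> depends_on A (\<lambda>x. \<Sum>v\<in>S. F v x)"
  unfolding depends_on_def by (intro allI impI sum.cong refl) blast

lemma depends_on_prod:
  "(\<And>v. v \<in> S \<Longrightarrow> depends_on A (F v)) \<Longrightarrow> depends_on A (\<lambda>x. \<Prod>v\<in>S. F v x)"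
  unfolding depends_on_def by (intro allI impI prod.cong refl) blast

lemma depends_on_restrict: "depends_on A F \<Longrightarrow> F (restrict x A) = F x"
  unfolding depends_on_def by simp

lemma depends_on_shift:
  fixes F :: "(int^'d \<Rightarrow> 'a) \<Rightarrow> 'c"
  shows "depends_on A F \<Longrightarrow> depends_on ((+) v ` A) (\<lambda>x. F (shift (- v) x))"
  unfolding depends_on_def shift_def by (simp add: add.commute)

lemma finite_range_depends_on:
  fixes F :: "('i \<Rightarrow> 'a::finite) \<Rightarrow> 'c"
  assumes "finite A" "depends_on A F"
  shows "finite (range F)"
proof (rule finite_subset)
  show "range F \<subseteq> F ` (PiE A (\<lambda>_. UNIV))"
  proof
    fix y assume "y \<in> range F"
    then obtain x where "y = F (restrict x A)"
      using depends_on_restrict[OF assms(2)] by (metis rangeE)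
    then show "y \<in> F ` (PiE A (\<lambda>_. UNIV))"
      by auto
  qed
  show "finite (F ` (PiE A (\<lambda>_. UNIV)))"
    using assms(1) by (intro finite_imageI finite_PiE) auto
qed

subsection \<open>Independent identically distributed fields\<close>

interpretation iid: prob_space "iid_measure p" for p
  unfolding iid_measure_def by (intro prob_space_PiM prob_space_measure_pmf)

lemma space_iid [simp]: "space (iid_measure p) = UNIV"
  by (auto simp: iid_measure_def space_PiM)

lemma prob_UNIV_iid [simp]: "measure (iid_measure p) UNIV = 1"
  using iid.prob_space[of p] by simp

lemma measurable_component_iid: "(\<lambda>x. x v) \<in> iid_measure p \<rightarrow>\<^sub>M measure_pmf p"
  unfolding iid_measure_def by (rule measurable_component_singleton) auto

lemma measurable_component_iid_count_space [measurable]: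
  "(\<lambda>x. x v) \<in> iid_measure p \<rightarrow>\<^sub>M count_space UNIV"
  using measurable_component_iid[of v p] by simp

lemma borel_measurable_component_iid [measurable]:
  "(\<lambda>x. f (x v) :: real) \<in> borel_measurable (iid_measure p)"
  by (rule measurable_compose[OF measurable_component_iid_count_space]) auto

lemma distr_component_iid: "distr (iid_measure p) (measure_pmf p) (\<lambda>x. x v) = measure_pmf p"
  unfolding iid_measure_def by (rule distr_PiM_component) (auto intro: prob_space_measure_pmf)

lemma AE_component_iid: "AE a in measure_pmf p. P a \<Longrightarrow> AE x in iid_measure p. P (x v)"
  unfolding iid_measure_def by (rule AE_PiM_component) (auto intro: prob_space_measure_pmf)

lemma integral_component_iid:
  fixes f :: "'a \<Rightarrow> real"
  shows "(\<integral>x. f (x v) \<partial>iid_measure p) = measure_pmf.expectation p f"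
proof -
  have "(\<integral>x. f (x v) \<partial>iid_measure p) = (\<integral>a. f a \<partial>distr (iid_measure p) (measure_pmf p) (\<lambda>x. x v))"
    by (subst integral_distr[OF measurable_component_iid]) auto
  then show ?thesis
    by (simp only: distr_component_iid)
qed

lemma variance_component_iid:
  fixes f :: "'a \<Rightarrow> real"
  shows "iid.variance p (\<lambda>x. f (x v)) = measure_pmf.variance p f"
  by (simp only: integral_component_iid[where f = f]
      integral_component_iid[where f = "\<lambda>a. (f a - measure_pmf.expectation p f)\<^sup>2"])

lemma indep_components_iid:
  "prob_space.indep_vars (iid_measure p :: (int^'d \<Rightarrow> 'a) measure) (\<lambda>_. measure_pmf p) (\<lambda>v x. x v) UNIV"
proof -
  have "distr (iid_measure p) (PiM UNIV (\<lambda>_. measure_pmf p)) (\<lambda>x. \<lambda>v\<in>UNIV. x v)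
    = PiM UNIV (\<lambda>v::int^'d. distr (iid_measure p) (measure_pmf p) (\<lambda>x. x v))"
    by (simp only: distr_component_iid restrict_UNIV) (simp add: iid_measure_def distr_id2)
  then show ?thesis
    by (subst iid.indep_vars_iff_distr_eq_PiM') (auto intro: measurable_component_iid)
qed

lemma measure_cylinder_iid:
  assumes "finite J"
  shows "measure (iid_measure p) {x. \<forall>v\<in>J. x v = w v} = (\<Prod>v\<in>J. pmf p (w v))"
proof -
  interpret product_prob_space "\<lambda>_. measure_pmf p" UNIV ..
  have "{x. \<forall>v\<in>J. x v = w v} = prod_emb UNIV (\<lambda>_. measure_pmf p) J (PiE J (\<lambda>v. {w v}))"
    by (auto simp: prod_emb_def PiE_iff restrict_def extensional_def)
  then show ?thesis
    unfolding iid_measure_def using assms by (simp add: measure_PiM_emb measure_pmf_single)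
qed

lemma sets_depends_on:
  fixes p :: "'a::finite pmf" and P :: "(int^'d \<Rightarrow> 'a) \<Rightarrow> bool"
  assumes "finite A" "depends_on A P"
  shows "{x. P x} \<in> sets (iid_measure p)"
proof -
  let ?W = "{w\<in>PiE A (\<lambda>_. UNIV). P w}"
  have cylinders: "{x. P x} = (\<Union>w\<in>?W. {x\<in>space (iid_measure p). \<forall>i\<in>A. x i = w i})"
  proof (intro set_eqI iffI)
    fix x assume "x \<in> {x. P x}"
    then show "x \<in> (\<Union>w\<in>?W. {x\<in>space (iid_measure p). \<forall>i\<in>A. x i = w i})"
      using depends_on_restrict[OF assms(2), of x] by (auto intro!: exI[of _ "restrict x A"])
  next
    fix x assume "x \<in> (\<Union>w\<in>?W. {x\<in>space (iid_measure p). \<forall>i\<in>A. x i = w i})"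
    then show "x \<in> {x. P x}"
      using depends_onD[OF assms(2)] by blast
  qed
  have "{x\<in>space (iid_measure p). \<forall>i\<in>A. x i = w i} \<in> sets (iid_measure p)" for w
    using assms(1) by measurable
  moreover have "finite ?W"
    using finite_PiE[OF assms(1), of "\<lambda>_. UNIV :: 'a set"] by (rule rev_finite_subset) auto
  ultimately show ?thesis
    unfolding cylinders by (intro sets.finite_UN) auto
qed

lemma measurable_depends_on:
  fixes p :: "'a::finite pmf" and F :: "(int^'d \<Rightarrow> 'a) \<Rightarrow> real"
  assumes "finite A" "depends_on A F"
  shows "F \<in> borel_measurable (iid_measure p)"
proof (rule measurableI)
  fix S :: "real set"
  show "F -` S \<inter> space (iid_measure p) \<in> sets (iid_measure p)"
    using sets_depends_on[OF assms(1) depends_on_compose[OF assms(2), of "\<lambda>y. y \<in> S"]]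
    by (simp add: vimage_def)
qed auto

lemma integrable_depends_on:
  fixes p :: "'a::finite pmf" and F :: "(int^'d \<Rightarrow> 'a) \<Rightarrow> real"
  assumes "finite A" "depends_on A F"
  shows "integrable (iid_measure p) F"
proof -
  have "bounded (range F)"
    by (rule finite_imp_bounded[OF finite_range_depends_on[OF assms]])
  then obtain b where "\<And>x. norm (F x) \<le> b"
    by (auto simp: bounded_iff)
  then show ?thesis
    using measurable_depends_on[OF assms] by (intro iid.integrable_const_bound[of _ b]) auto
qed

lemma integral_mult_depends_on:
  fixes p :: "'a::finite pmf" and F G :: "(int^'d \<Rightarrow> 'a) \<Rightarrow> real"
  assumes "finite A" "finite B" "A \<inter> B = {}" "depends_on A F" "depends_on B G"
  shows "(\<integral>x. F x * G x \<partial>iid_measure p) = (\<integral>x. F x \<partial>iid_measure p) * (\<integral>x. G x \<partial>iid_measure p)"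
proof -
  let ?P = "\<lambda>A. PiM A (\<lambda>_::int^'d. measure_pmf p)"
  have measurable_PiM: "H \<in> borel_measurable (?P S)" if "finite S" for H :: "_ \<Rightarrow> real" and S
  proof -
    have "sets (?P S) = sets (count_space (PiE S (\<lambda>_. UNIV)))"
      using that by (subst count_space_PiM_finite[symmetric]) (auto intro!: sets_PiM_cong)
    then show ?thesis
      by (subst measurable_cong_sets[of _ "count_space (PiE S (\<lambda>_. UNIV))", OF _ refl]) auto
  qed
  have "iid.indep_var p (?P A) (\<lambda>x. restrict (\<lambda>i. x i) A) (?P B) (\<lambda>x. restrict (\<lambda>i. x i) B)"
    using assms(3) by (intro iid.indep_var_restrict[OF indep_components_iid]) auto
  from iid.indep_var_compose[OF this measurable_PiM[OF assms(1), of F] measurable_PiM[OF assms(2), of G]]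
  have "iid.indep_var p borel F borel G"
    using depends_on_restrict[OF assms(4)] depends_on_restrict[OF assms(5)] by (simp add: comp_def)
  then show ?thesis
    using assms
    by (intro iid.indep_var_lebesgue_integral integrable_depends_on[of A F] integrable_depends_on[of B G])
qed

lemma measurable_shift_iid [measurable]: "shift u \<in> iid_measure p \<rightarrow>\<^sub>M iid_measure p"
  unfolding shift_def[abs_def] iid_measure_def
  by (rule measurable_PiM_single')
    (auto simp: space_PiM intro!: measurable_component_singleton simp del: measurable_pmf_measure2)

lemma distr_shift_iid: "distr (iid_measure p) (iid_measure p) (shift u) = iid_measure p"
proof -
  have "distr (iid_measure p) (iid_measure p) (\<lambda>x. \<lambda>v\<in>UNIV. x (v - u)) = iid_measure p"
    unfolding iid_measure_def
    by (rule distr_PiM_reindex[where f = "\<lambda>v. v - u"])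
      (auto simp: inj_on_def intro: prob_space_measure_pmf)
  then show ?thesis
    by (simp add: shift_def[abs_def] restrict_UNIV)
qed

lemma integral_shift_iid:
  fixes F :: "_ \<Rightarrow> real"
  assumes "F \<in> borel_measurable (iid_measure p)"
  shows "(\<integral>x. F (shift u x) \<partial>iid_measure p) = (\<integral>x. F x \<partial>iid_measure p)"
  using integral_distr[OF measurable_shift_iid[of u p] assms] by (simp add: distr_shift_iid)

lemma AE_shift_iid:
  assumes "AE x in iid_measure p. P x"
  shows "AE x in iid_measure p. P (shift u x)"
  by (rule AE_distrD[OF measurable_shift_iid[of u p]]) (unfold distr_shift_iid, rule assms)

subsection \<open>Centred sums\<close>

definition centred_sum :: "'a pmf \<Rightarrow> ('a \<Rightarrow> real) \<Rightarrow> (int^'d) set \<Rightarrow> (int^'d \<Rightarrow> 'a) \<Rightarrow> real" where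
  "centred_sum p f B x = (\<Sum>v\<in>B. f (x v) - measure_pmf.expectation p f)"

lemma depends_on_centred_sum: "depends_on B (centred_sum p f B)"
  unfolding centred_sum_def[abs_def]
  by (intro depends_on_sum depends_on_component[where g = "\<lambda>a. f a - measure_pmf.expectation p f"])

lemma measurable_centred_sum [measurable]: "centred_sum p f B \<in> borel_measurable (iid_measure r)"
  unfolding centred_sum_def[abs_def] by measurable

lemma indep_centred_components_iid:
  "prob_space.indep_vars (iid_measure p :: (int^'d \<Rightarrow> 'a) measure) (\<lambda>_. borel)
    (\<lambda>v x. f (x v) - measure_pmf.expectation p f) B"
  by (rule iid.indep_vars_subset[OF iid.indep_vars_compose2[OF indep_components_iid
        , where Y = "\<lambda>_ a. f a - measure_pmf.expectation p f" and N = "\<lambda>_. borel"]]) auto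

lemma integrable_centred_sum:
  fixes p :: "'a::finite pmf"
  shows "finite B \<Longrightarrow> integrable (iid_measure p) (centred_sum p f B)"
  by (rule integrable_depends_on[OF _ depends_on_centred_sum])

lemma expectation_centred_sum:
  fixes p :: "'a::finite pmf" and B :: "(int^'d) set"
  shows "(\<integral>x. centred_sum p f B x \<partial>iid_measure p) = 0"
proof -
  have "integrable (iid_measure p) (\<lambda>x. f (x v))" for v :: "int^'d"
    by (rule integrable_depends_on[of "{v}"]) (auto intro: depends_on_component)
  then show ?thesis
    by (simp add: centred_sum_def integral_component_iid)
qed

lemma expectation_centred_pmf:
  fixes p :: "'a::finite pmf" and f :: "'a \<Rightarrow> real"
  shows "measure_pmf.expectation p (\<lambda>a. f a - measure_pmf.expectation p f) = 0"
  by (simp add: integrable_measure_pmf_finite)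

lemma expectation_power2_centred_sum:
  fixes p :: "'a::finite pmf" and B :: "(int^'d) set"
  assumes "finite B"
  shows "(\<integral>x. (centred_sum p f B x)\<^sup>2 \<partial>iid_measure p) = real (card B) * measure_pmf.variance p f"
proof -
  let ?g = "\<lambda>a. f a - measure_pmf.expectation p f"
  have int_sq: "integrable (iid_measure p) (\<lambda>x. (?g (x v))\<^sup>2)" for v :: "int^'d"
    by (rule integrable_depends_on[of "{v}"]) (auto intro: depends_on_component[where g = "\<lambda>a. (?g a)\<^sup>2"])
  have "(\<integral>x. (centred_sum p f B x)\<^sup>2 \<partial>iid_measure p) = iid.variance p (centred_sum p f B)"
    by (simp add: expectation_centred_sum)
  also have "\<dots> = (\<Sum>v\<in>B. iid.variance p (\<lambda>x. ?g (x v)))"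
    unfolding centred_sum_def[abs_def]
    by (rule iid.variance_sum_indep[OF assms indep_centred_components_iid int_sq])
  finally show ?thesis
    by (simp only: variance_component_iid[where f = ?g] expectation_centred_pmf diff_zero sum_constant)
qed

lemma expectation_abs_centred_sum_le:
  fixes p :: "'a::finite pmf"
  assumes "finite B"
  shows "(\<integral>x. \<bar>centred_sum p f B x\<bar> \<partial>iid_measure p)
    \<le> sqrt (measure_pmf.variance p f) * sqrt (real (card B))"
proof -
  have "integrable (iid_measure p) (\<lambda>x. (centred_sum p f B x)\<^sup>2)"
    by (rule integrable_depends_on[OF assms depends_on_compose[OF depends_on_centred_sum]])
  from iid.expectation_abs_le_sqrt[OF integrable_centred_sum[OF assms] this]
  show ?thesis
    by (simp add: expectation_power2_centred_sum[OF assms] real_sqrt_mult mult.commute)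
qed

lemma char_centred_sum:
  fixes B :: "(int^'d) set"
  shows "char (distr (iid_measure p) borel (centred_sum p f B)) t
    = char (distr (measure_pmf p) borel (\<lambda>a. f a - measure_pmf.expectation p f)) t ^ card B"
proof -
  let ?g = "\<lambda>a. f a - measure_pmf.expectation p f"
  have "distr (iid_measure p) borel (\<lambda>x. ?g (x v)) = distr (measure_pmf p) borel ?g" for v :: "int^'d"
  proof -
    have "distr (measure_pmf p) borel ?g = distr (distr (iid_measure p) (measure_pmf p) (\<lambda>x. x v)) borel ?g"
      by (simp only: distr_component_iid)
    also have "\<dots> = distr (iid_measure p) borel (?g \<circ> (\<lambda>x. x v))"
      by (rule distr_distr[OF _ measurable_component_iid]) simp
    finally show ?thesis
      by (simp add: comp_def)
  qed
  then show ?thesis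
    unfolding centred_sum_def[abs_def]
    by (simp add: iid.char_distr_sum[OF indep_centred_components_iid])
qed

lemma char_normalised_centred_sum_tendsto:
  fixes p :: "'a::finite pmf" and B :: "nat \<Rightarrow> (int^'d) set"
  assumes card_at_top: "filterlim (\<lambda>n. card (B n)) at_top sequentially"
  shows "(\<lambda>n. char (distr (iid_measure p) borel (centred_sum p f (B n))) (t / sqrt (real (card (B n)))))
    \<longlonglongrightarrow> complex_of_real (exp (- (t\<^sup>2 * measure_pmf.variance p f / 2)))"
proof -
  let ?g = "\<lambda>a. f a - measure_pmf.expectation p f"
  interpret real_distribution "distr (measure_pmf p) borel ?g"
    by (rule prob_space.real_distribution_distr[OF prob_space_measure_pmf]) simp
  have int: "integrable (measure_pmf p) h" for h :: "'a \<Rightarrow> real"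
    by (rule integrable_measure_pmf_finite) simp
  have "(\<lambda>n. char (distr (measure_pmf p) borel ?g) (t / sqrt (real n)) ^ n)
      \<longlonglongrightarrow> complex_of_real (exp (- (t\<^sup>2 * measure_pmf.variance p f / 2)))"
    using char_power_tendsto_exp[of t] expectation_centred_pmf[of p f]
    by (simp add: integrable_distr_eq integral_distr int)
  from filterlim_compose[OF this card_at_top] show ?thesis
    by (simp add: char_centred_sum)
qed

subsection \<open>Cubes\<close>

definition cube :: "int \<Rightarrow> int \<Rightarrow> (int^'d) set" where
  "cube lo hi = {v. \<forall>i. lo \<le> v $ i \<and> v $ i < hi}"

lemma cube_eq_image: "cube lo hi = vec_lambda ` PiE UNIV (\<lambda>_. {lo..<hi})"
proof (intro set_eqI iffI)
  fix v :: "int^'d" assume "v \<in> cube lo hi"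
  then show "v \<in> vec_lambda ` PiE UNIV (\<lambda>_. {lo..<hi})"
    by (intro image_eqI[of _ _ "vec_nth v"]) (auto simp: cube_def)
qed (auto simp: cube_def)

lemma finite_cube [simp]: "finite (cube lo hi)"
  unfolding cube_eq_image by (intro finite_imageI finite_PiE) auto

lemma card_cube: "card (cube lo hi :: (int^'d) set) = nat (hi - lo) ^ CARD('d)"
proof -
  have "inj_on (vec_lambda :: ('d \<Rightarrow> int) \<Rightarrow> _) (PiE UNIV (\<lambda>_. {lo..<hi}))"
    by (auto simp: inj_on_def vec_lambda_inject)
  then show ?thesis
    unfolding cube_eq_image by (simp add: card_image card_PiE)
qed

lemma cube_mono: "lo' \<le> lo \<Longrightarrow> hi \<le> hi' \<Longrightarrow> cube lo hi \<subseteq> cube lo' hi'"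
  unfolding cube_def by (auto intro: order_trans less_le_trans)

lemma card_cube_Diff_cube:
  assumes "lo \<le> lo'" "hi' \<le> hi"
  shows "real (card (cube lo hi - cube lo' hi' :: (int^'d) set))
    = real (nat (hi - lo)) ^ CARD('d) - real (nat (hi' - lo')) ^ CARD('d)"
proof -
  have "cube lo' hi' \<subseteq> (cube lo hi :: (int^'d) set)"
    using assms by (rule cube_mono)
  then have "real (card (cube lo hi - cube lo' hi' :: (int^'d) set))
      = real (card (cube lo hi :: (int^'d) set)) - real (card (cube lo' hi' :: (int^'d) set))"
    by (simp add: card_Diff_subset card_mono of_nat_diff)
  then show ?thesis
    by (simp add: card_cube)
qed

lemma zero_mem_box [simp]: "0 \<in> box n"
  by (simp add: box_def)

lemma finite_box [simp]: "finite (box n)"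
proof (rule finite_subset)
  show "box n \<subseteq> cube (- int n) (int n + 1)"
    by (auto simp: box_def cube_def abs_le_iff minus_le_iff)
qed simp

lemma translate_box_subset_cube:
  fixes v :: "int^'d"
  assumes "v \<in> cube lo hi"
  shows "(+) v ` box n \<subseteq> cube (lo - int n) (hi + int n)"
proof
  fix u assume "u \<in> (+) v ` box n"
  then obtain w where w: "w \<in> box n" "u = v + w"
    by blast
  have "lo - int n \<le> u $ i \<and> u $ i < hi + int n" for i
  proof -
    have "\<bar>w $ i\<bar> \<le> int n" "lo \<le> v $ i" "v $ i < hi"
      using assms w(1) by (auto simp: box_def cube_def)
    then show ?thesis
      by (simp add: w(2)) linarith
  qed
  then show "u \<in> cube (lo - int n) (hi + int n)"
    by (simp add: cube_def)
qed

lemma sum_cube_tiling: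
  fixes f :: "int^'d \<Rightarrow> 'b::comm_monoid_add"
  assumes "0 < l"
  shows "(\<Sum>v\<in>cube 0 (l * m). f v) = (\<Sum>i\<in>cube 0 m. \<Sum>w\<in>cube 0 l. f (w + l *s i))"
proof -
  have mult_add_bounds: "0 \<le> w + l * i \<and> w + l * i < l * m" if "0 \<le> w" "w < l" "0 \<le> i" "i < m" for w i
  proof -
    have "l * (i + 1) \<le> l * m"
      using assms that by (intro mult_left_mono) auto
    then show ?thesis
      using assms that by (simp add: distrib_left)
  qed
  have div_less: "v div l < m" if "v < l * m" for v
  proof -
    have "l * (v div l) \<le> v"
      using assms by (simp add: minus_mod_eq_mult_div[symmetric])
    also note that
    finally show ?thesis
      using assms by (simp add: mult_less_cancel_left_pos)
  qed
  have div_mod: "(\<chi> c. v $ c mod l) + l *s (\<chi> c. v $ c div l) = v" for v :: "int^'d"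
    by (simp add: vec_eq_iff)
  have "(\<Sum>v\<in>cube 0 (l * m). f v) = (\<Sum>(i, w)\<in>cube 0 m \<times> cube 0 l. f (w + l *s i))"
    by (rule sum.reindex_bij_witness[where i = "\<lambda>(i, w). w + l *s i"
          and j = "\<lambda>v. (\<chi> c. v $ c div l, \<chi> c. v $ c mod l)"])
      (use assms mult_add_bounds div_less in \<open>auto simp: div_mod cube_def vec_eq_iff pos_imp_zdiv_nonneg_iff\<close>)
  then show ?thesis
    by (simp add: sum.cartesian_product)
qed

lemma translated_cubes_disjoint:
  fixes i j :: "int^'d"
  assumes "0 < l" "i \<noteq> j"
  shows "(+) (l *s i) ` cube (- k) (l + k) \<inter> (+) (l *s j) ` cube k (l - k) = {}"
proof -
  obtain c where neq: "i $ c \<noteq> j $ c"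
    using assms(2) by (auto simp: vec_eq_iff)
  have "l * i $ c + v $ c \<noteq> l * j $ c + w $ c"
    if "v \<in> cube (- k) (l + k)" "w \<in> cube k (l - k)" for v w :: "int^'d"
  proof (cases "i $ c < j $ c")
    case True
    then have "l * (i $ c + 1) \<le> l * j $ c"
      using assms(1) by (intro mult_left_mono) auto
    moreover have "v $ c < l + k" "k \<le> w $ c"
      using that by (auto simp: cube_def)
    ultimately show ?thesis
      by (simp add: distrib_left)
  next
    case False
    then have "l * (j $ c + 1) \<le> l * i $ c"
      using neq assms(1) by (intro mult_left_mono) auto
    moreover have "- k \<le> v $ c" "w $ c < l - k"
      using that by (auto simp: cube_def)
    ultimately show ?thesis
      by (simp add: distrib_left)
  qed
  then show ?thesis
    by (fastforce simp: vec_eq_iff)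
qed

subsection \<open>Tilting by a product density\<close>

lemma integral_mult_prod_depends_on:
  fixes p :: "'a::finite pmf" and F :: "(int^'d \<Rightarrow> 'a) \<Rightarrow> real"
  assumes "finite J" "finite E" "\<And>j. j \<in> J \<Longrightarrow> finite (B j)" "disjoint_family_on B J"
    and "\<And>j. j \<in> J \<Longrightarrow> E \<inter> B j = {}"
    and "depends_on E F" "\<And>j. j \<in> J \<Longrightarrow> depends_on (B j) (g j)"
    and "\<And>j. j \<in> J \<Longrightarrow> (\<integral>x. g j x \<partial>iid_measure p) = 1"
  shows "(\<integral>x. F x * (\<Prod>j\<in>J. g j x) \<partial>iid_measure p) = (\<integral>x. F x \<partial>iid_measure p)"
  using assms
proof (induction J rule: finite_induct)
  case empty
  then show ?case
    by simp
next
  case (insert j J)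
  let ?A = "E \<union> (\<Union>k\<in>J. B k)"
  have disjoint: "?A \<inter> B j = {}"
    using insert.prems(3,4) insert.hyps(2) by (fastforce simp: disjoint_family_on_def)
  have "depends_on ?A (\<lambda>x. F x * (\<Prod>j\<in>J. g j x))"
  proof (intro depends_on_compose2[where g = "(*)"] depends_on_prod)
    show "depends_on ?A F"
      by (rule depends_on_mono[OF insert.prems(5)]) auto
    show "depends_on ?A (g k)" if "k \<in> J" for k
      using that by (intro depends_on_mono[OF insert.prems(6)[of k]]) auto
  qed
  then have "(\<integral>x. (F x * (\<Prod>j\<in>J. g j x)) * g j x \<partial>iid_measure p)
      = (\<integral>x. F x * (\<Prod>j\<in>J. g j x) \<partial>iid_measure p) * (\<integral>x. g j x \<partial>iid_measure p)"
    using insert.hyps insert.prems(1,2) disjoint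
    by (intro integral_mult_depends_on[of ?A "B j"] insert.prems) auto
  also have "\<dots> = (\<integral>x. F x \<partial>iid_measure p)"
    using insert.prems by (simp add: insert.IH disjoint_family_on_def)
  finally show ?case
    using insert.hyps by (simp add: mult_ac)
qed

lemma integral_prod_mult_depends_on:
  fixes p :: "'a::finite pmf" and F :: "(int^'d \<Rightarrow> 'a) \<Rightarrow> real"
  assumes finite_J: "finite J" and i: "i \<in> J" and "finite E" "\<And>j. j \<in> J \<Longrightarrow> finite (B j)" "disjoint_family_on B J"
    and "B i \<subseteq> E" "\<And>j. j \<in> J - {i} \<Longrightarrow> E \<inter> B j = {}"
    and dep_F: "depends_on E F" and dep_g: "\<And>j. j \<in> J \<Longrightarrow> depends_on (B j) (g j)"
    and "\<And>j. j \<in> J \<Longrightarrow> (\<integral>x. g j x \<partial>iid_measure p) = 1"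
  shows "(\<integral>x. (\<Prod>j\<in>J. g j x) * F x \<partial>iid_measure p) = (\<integral>x. g i x * F x \<partial>iid_measure p)"
proof -
  have "depends_on E (\<lambda>x. g i x * F x)"
    by (rule depends_on_compose2[OF depends_on_mono[OF dep_g[OF i] \<open>B i \<subseteq> E\<close>] dep_F])
  then have "(\<integral>x. (g i x * F x) * (\<Prod>j\<in>J - {i}. g j x) \<partial>iid_measure p) = (\<integral>x. g i x * F x \<partial>iid_measure p)"
    using assms disjoint_family_on_mono[of "J - {i}" J B]
    by (intro integral_mult_prod_depends_on[where B = B and E = E]) auto
  moreover have "(g i x * F x) * (\<Prod>j\<in>J - {i}. g j x) = (\<Prod>j\<in>J. g j x) * F x" for x
    using prod.remove[OF finite_J i, of "\<lambda>j. g j x"] by simp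
  ultimately show ?thesis
    by simp
qed

text \<open>A pointwise bound on a sum may be integrated against the density \<open>\<Prod>\<^sub>j g j\<close>, of which the
  \<open>i\<close>-th term only feels the \<open>i\<close>-th factor.\<close>
lemma sum_tilted_integral_le:
  fixes p :: "'a::finite pmf" and F g :: "'j \<Rightarrow> (int^'d \<Rightarrow> 'a) \<Rightarrow> real"
  assumes finite_J: "finite J" and finite_E: "\<And>j. j \<in> J \<Longrightarrow> finite (E j)"
    and B_subset_E: "\<And>j. j \<in> J \<Longrightarrow> B j \<subseteq> E j"
    and disjoint: "\<And>i j. i \<in> J \<Longrightarrow> j \<in> J \<Longrightarrow> i \<noteq> j \<Longrightarrow> E i \<inter> B j = {}"
    and dep_g: "\<And>j. j \<in> J \<Longrightarrow> depends_on (B j) (g j)"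
    and dep_F: "\<And>j. j \<in> J \<Longrightarrow> depends_on (E j) (F j)"
    and g_nonneg: "\<And>j x. j \<in> J \<Longrightarrow> 0 \<le> g j x"
    and mean_g: "\<And>j. j \<in> J \<Longrightarrow> (\<integral>x. g j x \<partial>iid_measure p) = 1"
    and sum_le: "AE x in iid_measure p. (\<Sum>j\<in>J. F j x) \<le> b"
  shows "(\<Sum>i\<in>J. \<integral>x. g i x * F i x \<partial>iid_measure p) \<le> b"
proof -
  let ?G = "\<lambda>x. \<Prod>j\<in>J. g j x"
  have finite_B: "finite (B j)" if "j \<in> J" for j
    using finite_subset[OF B_subset_E finite_E] that by blast
  have disjoint_B: "disjoint_family_on B J"
    using disjoint B_subset_E by (fastforce simp: disjoint_family_on_def)
  have mean_G: "(\<integral>x. ?G x \<partial>iid_measure p) = 1"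
    using integral_mult_prod_depends_on[of J "{}" B "\<lambda>_. 1" g p] finite_J finite_B disjoint_B dep_g mean_g
    by (simp add: depends_on_def)
  have tilt: "(\<integral>x. g i x * F i x \<partial>iid_measure p) = (\<integral>x. ?G x * F i x \<partial>iid_measure p)" if "i \<in> J" for i
    using that disjoint
    by (intro integral_prod_mult_depends_on[symmetric, where B = B and E = "E i"] finite_J finite_E finite_B
        disjoint_B B_subset_E dep_g dep_F mean_g) auto
  have dep_G: "depends_on (\<Union>j\<in>J. E j) ?G"
    using B_subset_E by (intro depends_on_prod depends_on_mono[OF dep_g]) auto
  have int_G: "integrable (iid_measure p) ?G"
    using finite_J finite_E by (intro integrable_depends_on[OF _ dep_G]) auto
  have int_GF: "integrable (iid_measure p) (\<lambda>x. ?G x * F i x)" if "i \<in> J" for i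
  proof (rule integrable_depends_on)
    show "depends_on (\<Union>j\<in>J. E j) (\<lambda>x. ?G x * F i x)"
      using that by (intro depends_on_compose2[where g = "(*)"] dep_G depends_on_mono[OF dep_F]) auto
  qed (use finite_J finite_E in auto)
  have "(\<Sum>i\<in>J. \<integral>x. g i x * F i x \<partial>iid_measure p) = (\<integral>x. ?G x * (\<Sum>i\<in>J. F i x) \<partial>iid_measure p)"
    using int_GF by (simp add: tilt sum_distrib_left)
  also have "\<dots> \<le> (\<integral>x. ?G x * b \<partial>iid_measure p)"
  proof (rule integral_mono_AE)
    show "AE x in iid_measure p. ?G x * (\<Sum>i\<in>J. F i x) \<le> ?G x * b"
      using sum_le by eventually_elim (intro mult_left_mono prod_nonneg ballI g_nonneg)
  qed (use int_G int_GF in \<open>auto simp: sum_distrib_left\<close>)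
  also have "\<dots> = b"
    by (simp add: mean_G)
  finally show ?thesis .
qed

text \<open>The margin \<open>k\<close> keeps the support of each summand away from the other factors of the
  density.\<close>
lemma tilted_tile_le:
  fixes p :: "'a::finite pmf" and \<psi> G :: "(int^'d \<Rightarrow> 'a) \<Rightarrow> real"
  assumes "0 < l" "0 \<le> k" "finite J"
    and dep_\<psi>: "depends_on (cube k (l - k)) \<psi>" and dep_G: "depends_on (cube (- k) (l + k)) G"
    and \<psi>_le: "\<And>x. \<bar>\<psi> x\<bar> \<le> 1" and mean_\<psi>: "(\<integral>x. \<psi> x \<partial>iid_measure p) = 0"
    and sum_le: "AE x in iid_measure p. (\<Sum>i\<in>J. G (shift (- (l *s i)) x)) \<le> b"
  shows "real (card J) * (\<integral>x. (1 + \<psi> x) * G x \<partial>iid_measure p) \<le> b"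
proof -
  have [measurable]: "\<psi> \<in> borel_measurable (iid_measure p)" "G \<in> borel_measurable (iid_measure p)"
    using dep_\<psi> dep_G by (auto intro: measurable_depends_on[rotated])
  have int_\<psi>: "integrable (iid_measure p) \<psi>"
    using dep_\<psi> by (rule integrable_depends_on[rotated]) simp
  define g where "g i x = 1 + \<psi> (shift (- (l *s i)) x)" for i x
  have "(\<Sum>i\<in>J. \<integral>x. g i x * G (shift (- (l *s i)) x) \<partial>iid_measure p) \<le> b"
  proof (rule sum_tilted_integral_le[OF \<open>finite J\<close> _ _ translated_cubes_disjoint[OF \<open>0 < l\<close>, where k = k]])
    fix i :: "int^'d"
    show "(+) (l *s i) ` cube k (l - k) \<subseteq> (+) (l *s i) ` cube (- k) (l + k)"
      using \<open>0 \<le> k\<close> by (intro image_mono cube_mono) auto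
    show "depends_on ((+) (l *s i) ` cube k (l - k)) (g i)"
      unfolding g_def[abs_def]
      by (rule depends_on_compose[OF depends_on_shift[OF dep_\<psi>], where g = "\<lambda>y. 1 + y"])
    show "depends_on ((+) (l *s i) ` cube (- k) (l + k)) (\<lambda>x. G (shift (- (l *s i)) x))"
      by (rule depends_on_shift[OF dep_G])
    show "0 \<le> g i x" for x
      using \<psi>_le[of "shift (- (l *s i)) x"] by (simp add: g_def abs_le_iff)
    have "(\<integral>x. g i x \<partial>iid_measure p) = (\<integral>x. 1 + \<psi> x \<partial>iid_measure p)"
      unfolding g_def by (rule integral_shift_iid[where F = "\<lambda>x. 1 + \<psi> x"]) simp
    then show "(\<integral>x. g i x \<partial>iid_measure p) = 1"
      using int_\<psi> mean_\<psi> by simp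
  qed (use sum_le in auto)
  moreover have "(\<integral>x. g i x * G (shift (- (l *s i)) x) \<partial>iid_measure p)
      = (\<integral>x. (1 + \<psi> x) * G x \<partial>iid_measure p)" for i
    unfolding g_def by (rule integral_shift_iid[where F = "\<lambda>x. (1 + \<psi> x) * G x"]) simp
  ultimately show ?thesis
    by simp
qed

subsection \<open>Information\<close>

lemma info_fun_nonneg: "0 \<le> info_fun p a"
  by (cases "pmf p a = 0") (auto simp: info_fun_def pmf_le_1 pmf_pos)

lemma expectation_info_fun:
  fixes p :: "'a::finite pmf"
  shows "measure_pmf.expectation p (info_fun p) = entropy_pv p"
proof -
  have "info_fun p a * pmf p a = - (pmf p a * ln (pmf p a))" for a
    by (cases "pmf p a = 0") (auto simp: info_fun_def ln_div)
  then show ?thesis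
    by (simp add: integral_measure_pmf_real[of UNIV] entropy_pv_def sum_negf)
qed

lemma sum_info_fun:
  assumes "finite L" "\<And>v. v \<in> L \<Longrightarrow> 0 < pmf p (a v)"
  shows "(\<Sum>v\<in>L. info_fun p (a v)) = - ln (\<Prod>v\<in>L. pmf p (a v))"
proof -
  have "ln (\<Prod>v\<in>L. pmf p (a v)) = (\<Sum>v\<in>L. ln (pmf p (a v)))"
    by (intro ln_prod assms(1)) (auto dest: assms(2))
  moreover have "info_fun p (a v) = - ln (pmf p (a v))" if "v \<in> L" for v
    using assms(2)[OF that] by (simp add: info_fun_def ln_div)
  ultimately show ?thesis
    by (simp add: sum_negf)
qed

subsection \<open>Local approximations of a homomorphism\<close>

locale iid_homomorphism =
  fixes p :: "'a::finite pmf" and q :: "'b::finite pmf"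
    and \<phi> :: "(int^'d \<Rightarrow> 'a) \<Rightarrow> (int^'d \<Rightarrow> 'b)"
  assumes homomorphism: "is_homomorphism (iid_measure p) (iid_measure q) \<phi>"
begin

abbreviation \<mu> :: "(int^'d \<Rightarrow> 'a) measure" where
  "\<mu> \<equiv> iid_measure p"

lemma measurable_phi [measurable]: "\<phi> \<in> \<mu> \<rightarrow>\<^sub>M iid_measure q"
  and AE_phi_shift: "AE x in \<mu>. \<forall>u. \<phi> (shift u x) = shift u (\<phi> x)"
  and distr_phi: "distr \<mu> (iid_measure q) \<phi> = iid_measure q"
  using homomorphism by (auto simp: is_homomorphism_def)

lemma integral_phi:
  fixes F :: "_ \<Rightarrow> real"
  shows "F \<in> borel_measurable (iid_measure q) \<Longrightarrow> (\<integral>x. F (\<phi> x) \<partial>\<mu>) = (\<integral>y. F y \<partial>iid_measure q)"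
  using integral_distr[OF measurable_phi, of F] by (simp add: distr_phi)

lemma integrable_phi:
  fixes F :: "_ \<Rightarrow> real"
  shows "integrable (iid_measure q) F \<Longrightarrow> integrable \<mu> (\<lambda>x. F (\<phi> x))"
  using integrable_distr[OF measurable_phi, of F] by (simp add: distr_phi)

definition info_bound :: real where
  "info_bound = Max (range (info_fun p) \<union> range (info_fun q))"

lemma info_fun_p_le: "info_fun p a \<le> info_bound" and info_fun_q_le: "info_fun q b \<le> info_bound"
  unfolding info_bound_def by (auto intro: Max_ge)

lemma info_bound_nonneg: "0 \<le> info_bound"
  using info_fun_nonneg info_fun_p_le by (rule order_trans)

definition codes :: "nat \<Rightarrow> (int^'d \<Rightarrow> 'a) \<Rightarrow> 'b \<Rightarrow> bool" where
  "codes n x b \<longleftrightarrow> (AE a in \<mu>. (\<forall>i\<in>box n. a i = x i) \<longrightarrow> \<phi> a 0 = b)"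

definition determined :: "nat \<Rightarrow> (int^'d \<Rightarrow> 'a) \<Rightarrow> bool" where
  "determined n x \<longleftrightarrow> (\<exists>b. codes n x b)"

definition undetermined_prob :: "nat \<Rightarrow> real" where
  "undetermined_prob n = measure \<mu> {x. \<not> determined n x}"

lemma undetermined_prob_nonneg: "0 \<le> undetermined_prob n"
  by (simp add: undetermined_prob_def)

text \<open>Arbitrary unless the pattern on the box determines the symbol at the origin.\<close>
definition code :: "nat \<Rightarrow> (int^'d \<Rightarrow> 'a) \<Rightarrow> 'b" where
  "code n x = (SOME b. codes n x b)"

lemma codes_code: "determined n x \<Longrightarrow> codes n x (code n x)"
  unfolding determined_def code_def by (rule someI_ex)

lemma depends_on_codes: "depends_on (box n) (codes n)"
proof (rule depends_onI)
  fix x y :: "int^'d \<Rightarrow> 'a"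
  assume "\<And>i. i \<in> box n \<Longrightarrow> x i = y i"
  then have "(\<forall>i\<in>box n. a i = x i) \<longleftrightarrow> (\<forall>i\<in>box n. a i = y i)" for a
    by auto
  then show "codes n x = codes n y"
    by (simp add: codes_def fun_eq_iff)
qed

lemma depends_on_determined: "depends_on (box n) (determined n)"
  unfolding determined_def[abs_def] by (rule depends_on_compose[OF depends_on_codes])

lemma depends_on_code: "depends_on (box n) (code n)"
  unfolding code_def[abs_def] by (rule depends_on_compose[OF depends_on_codes])

lemma AE_phi_0_eq_code: "AE x in \<mu>. determined n x \<longrightarrow> \<phi> x 0 = code n x"
proof -
  let ?W = "PiE (box n :: (int^'d) set) (\<lambda>_. UNIV :: 'a set)"
  have "AE x in \<mu>. \<forall>w\<in>?W. determined n w \<longrightarrow> (\<forall>i\<in>box n. x i = w i) \<longrightarrow> \<phi> x 0 = code n w"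
  proof (rule AE_finite_allI)
    show "finite ?W"
      by (intro finite_PiE) auto
    show "AE x in \<mu>. determined n w \<longrightarrow> (\<forall>i\<in>box n. x i = w i) \<longrightarrow> \<phi> x 0 = code n w" for w
      using codes_code[of n w] by (cases "determined n w") (auto simp: codes_def)
  qed
  then show ?thesis
  proof eventually_elim
    case (elim x)
    show ?case
      using bspec[OF elim, of "restrict x (box n)"]
      by (simp add: depends_on_restrict[OF depends_on_determined] depends_on_restrict[OF depends_on_code])
  qed
qed

lemma AE_phi_eq_code:
  "AE x in \<mu>. determined n (shift (- v) x) \<longrightarrow> \<phi> x v = code n (shift (- v) x)"
  using AE_shift_iid[OF AE_phi_0_eq_code[of n], of "- v"] AE_phi_shift
proof eventually_elim
  case (elim x)
  then show ?case
    by (metis add.left_neutral diff_minus_eq_add shift_def)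
qed

lemma prod_pmf_le_prod_pmf_code:
  assumes finite_L: "finite L" and finite_K: "finite K" and neighbourhoods: "\<And>v. v \<in> K \<Longrightarrow> (+) v ` box n \<subseteq> L"
    and det: "\<And>v. v \<in> K \<Longrightarrow> determined n (shift (- v) a)"
  shows "(\<Prod>v\<in>L. pmf p (a v)) \<le> (\<Prod>v\<in>K. pmf q (code n (shift (- v) a)))"
proof -
  let ?A = "{x. \<forall>v\<in>L. x v = a v}" and ?B = "{y. \<forall>v\<in>K. y v = code n (shift (- v) a)}"
  have sets_B: "?B \<in> sets (iid_measure q)"
    using finite_K by (intro sets_depends_on[of K] depends_onI) auto
  have "AE x in \<mu>. \<forall>v\<in>K. determined n (shift (- v) x) \<longrightarrow> \<phi> x v = code n (shift (- v) x)"
    using finite_K AE_phi_eq_code by (intro AE_finite_allI)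
  then have "AE x in \<mu>. x \<in> ?A \<longrightarrow> x \<in> \<phi> -` ?B \<inter> space \<mu>"
  proof eventually_elim
    case (elim x)
    have "\<phi> x v = code n (shift (- v) a)" if "x \<in> ?A" and v: "v \<in> K" for v
    proof -
      have "shift (- v) x i = shift (- v) a i" if "i \<in> box n" for i
        using \<open>x \<in> ?A\<close> neighbourhoods[OF v] that by (auto simp: shift_def add.commute)
      then have "determined n (shift (- v) x) = determined n (shift (- v) a)"
        and "code n (shift (- v) x) = code n (shift (- v) a)"
        by (rule depends_onD[OF depends_on_determined] depends_onD[OF depends_on_code], simp)+
      then show ?thesis
        using elim v det by auto
    qed
    then show ?case
      by simp
  qed
  then have "measure \<mu> ?A \<le> measure \<mu> (\<phi> -` ?B \<inter> space \<mu>)"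
    using measurable_sets[OF measurable_phi sets_B] by (rule iid.finite_measure_mono_AE)
  also have "\<dots> = measure (distr \<mu> (iid_measure q) \<phi>) ?B"
    by (rule measure_distr[OF measurable_phi sets_B, symmetric])
  finally show ?thesis
    by (simp add: distr_phi measure_cylinder_iid finite_L finite_K)
qed

definition local_info :: "nat \<Rightarrow> (int^'d \<Rightarrow> 'a) \<Rightarrow> real" where
  "local_info n x = (if determined n x then info_fun q (code n x) else 0)"

lemma depends_on_local_info: "depends_on (box n) (local_info n)"
  unfolding local_info_def[abs_def]
  by (rule depends_on_compose2[OF depends_on_determined depends_on_code])

lemma AE_sum_local_info_le:
  assumes finite_L: "finite L" and finite_K: "finite K" and neighbourhoods: "\<And>v. v \<in> K \<Longrightarrow> (+) v ` box n \<subseteq> L"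
  shows "AE x in \<mu>. (\<Sum>v\<in>K. local_info n (shift (- v) x)) \<le> (\<Sum>v\<in>L. info_fun p (x v))"
proof -
  have "AE x in \<mu>. \<forall>v\<in>L. 0 < pmf p (x v)"
    using finite_L by (intro AE_finite_allI AE_component_iid) (auto simp: AE_measure_pmf_iff pmf_positive)
  then show ?thesis
  proof eventually_elim
    case (elim x)
    let ?D = "{v\<in>K. determined n (shift (- v) x)}"
    have le: "(\<Prod>v\<in>L. pmf p (x v)) \<le> (\<Prod>v\<in>?D. pmf q (code n (shift (- v) x)))"
      using finite_L finite_K neighbourhoods by (intro prod_pmf_le_prod_pmf_code) auto
    have pos_p: "0 < (\<Prod>v\<in>L. pmf p (x v))"
      using elim by (intro prod_pos) auto
    then have "(\<Prod>v\<in>?D. pmf q (code n (shift (- v) x))) \<noteq> 0"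
      using le by linarith
    then have pos_q: "0 < pmf q (code n (shift (- v) x))" if "v \<in> ?D" for v
      using that finite_K by (auto simp: less_le)
    have "(\<Sum>v\<in>K. local_info n (shift (- v) x)) = (\<Sum>v\<in>?D. info_fun q (code n (shift (- v) x)))"
      using finite_K by (simp add: local_info_def sum.inter_filter)
    also have "\<dots> = - ln (\<Prod>v\<in>?D. pmf q (code n (shift (- v) x)))"
      using finite_K pos_q by (intro sum_info_fun) auto
    also have "\<dots> \<le> - ln (\<Prod>v\<in>L. pmf p (x v))"
      using le pos_p by simp
    also have "\<dots> = (\<Sum>v\<in>L. info_fun p (x v))"
      using finite_L elim by (intro sum_info_fun[symmetric]) auto
    finally show ?case .
  qed
qed

subsection \<open>The tail of the coding radius\<close>

lemma determined_if_coding_radius_le: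
  assumes "coding_radius \<mu> \<phi> x \<le> enat n"
  shows "determined n x"
proof -
  let ?P = "\<lambda>n. AE a in \<mu>. (\<forall>i\<in>box n. a i = x i) \<longrightarrow> \<phi> a 0 = \<phi> x 0"
  have ex: "\<exists>n. ?P n"
    using assms by (auto simp: coding_radius_def Let_def split: if_splits)
  then have "(LEAST n. ?P n) \<le> n"
    using assms by (simp add: coding_radius_def Let_def)
  then have "box (LEAST n. ?P n) \<subseteq> box n"
    by (auto simp: box_def intro: order_trans)
  moreover have "?P (LEAST n. ?P n)"
    using ex by (rule LeastI_ex)
  ultimately have "?P n"
    by (auto elim!: eventually_mono)
  then show ?thesis
    by (auto simp: determined_def codes_def)
qed

lemma powr_mult_undetermined_prob_tendsto_0:
  assumes "finitary \<mu> \<phi>" and "0 < \<alpha>"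
    and int: "integrable \<mu> (\<lambda>x. real (the_enat (coding_radius \<mu> \<phi> x)) powr \<alpha>)"
  shows "(\<lambda>n. real n powr \<alpha> * undetermined_prob n) \<longlonglongrightarrow> 0"
proof -
  let ?R = "\<lambda>x. the_enat (coding_radius \<mu> \<phi> x)"
  let ?A = "\<lambda>n. {x\<in>space \<mu>. real n powr \<alpha> \<le> real (?R x) powr \<alpha>}"
  have "filterlim (\<lambda>n. real n powr \<alpha>) at_top sequentially"
    using \<open>0 < \<alpha>\<close> by real_asymp
  from iid.tendsto_mult_prob_ge_0[OF int this]
  have tail: "(\<lambda>n. real n powr \<alpha> * measure \<mu> (?A n)) \<longlonglongrightarrow> 0"
    by simp
  have "undetermined_prob n \<le> measure \<mu> (?A n)" for n
    unfolding undetermined_prob_def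
  proof (rule iid.finite_measure_mono_AE)
    show "?A n \<in> sets \<mu>"
      using borel_measurable_integrable[OF int] by measurable
    show "AE x in \<mu>. x \<in> {x. \<not> determined n x} \<longrightarrow> x \<in> ?A n"
      using \<open>finitary \<mu> \<phi>\<close> unfolding finitary_def
    proof eventually_elim
      case (elim x)
      then obtain r where "coding_radius \<mu> \<phi> x = enat r"
        by (cases "coding_radius \<mu> \<phi> x") auto
      then show ?case
        using determined_if_coding_radius_le[of x n] \<open>0 < \<alpha>\<close>
        by (cases "r \<le> n") (auto intro!: powr_mono2)
    qed
  qed
  then have "\<forall>\<^sub>F n in sequentially. norm (real n powr \<alpha> * undetermined_prob n)
      \<le> real n powr \<alpha> * measure \<mu> (?A n)"
    by (simp add: mult_left_mono undetermined_prob_nonneg)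
  then show ?thesis
    using tail by (rule Lim_null_comparison)
qed

subsection \<open>The local information difference\<close>

definition local_info_diff :: "nat \<Rightarrow> (int^'d) set \<Rightarrow> (int^'d \<Rightarrow> 'a) \<Rightarrow> real" where
  "local_info_diff n B x = (\<Sum>v\<in>B. local_info n (shift (- v) x) - info_fun p (x v))"

lemma depends_on_local_info_diff:
  assumes "\<And>v. v \<in> B \<Longrightarrow> (+) v ` box n \<subseteq> A"
  shows "depends_on A (local_info_diff n B)"
  unfolding local_info_diff_def[abs_def]
proof (intro depends_on_sum depends_on_compose2[where g = "(-)"])
  fix v assume v: "v \<in> B"
  show "depends_on A (\<lambda>x. local_info n (shift (- v) x))"
    by (rule depends_on_mono[OF depends_on_shift[OF depends_on_local_info] assms[OF v]])
  have "v + 0 \<in> A"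
    using assms[OF v] zero_mem_box by blast
  then show "depends_on A (\<lambda>x. info_fun p (x v))"
    by (intro depends_on_component) simp
qed

lemma depends_on_local_info_diff_cube:
  "depends_on (cube (lo - int n) (hi + int n)) (local_info_diff n (cube lo hi))"
  by (rule depends_on_local_info_diff[OF translate_box_subset_cube])

lemma AE_local_info_diff_le:
  assumes finite_L: "finite L" and neighbourhoods: "\<And>v. v \<in> K \<Longrightarrow> (+) v ` box n \<subseteq> L"
  shows "AE x in \<mu>. local_info_diff n K x \<le> info_bound * real (card (L - K))"
proof -
  have "v + 0 \<in> L" if "v \<in> K" for v
    using neighbourhoods[OF that] zero_mem_box by blast
  then have "K \<subseteq> L"
    by auto
  then have "finite K"
    using finite_L by (rule finite_subset)
  with finite_L have "AE x in \<mu>. (\<Sum>v\<in>K. local_info n (shift (- v) x)) \<le> (\<Sum>v\<in>L. info_fun p (x v))"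
    using neighbourhoods by (rule AE_sum_local_info_le)
  then show ?thesis
  proof eventually_elim
    case (elim x)
    have "(\<Sum>v\<in>L - K. info_fun p (x v)) \<le> info_bound * real (card (L - K))"
      using sum_bounded_above[of "L - K" "\<lambda>v. info_fun p (x v)" info_bound] info_fun_p_le
      by (simp add: mult.commute)
    then show ?case
      using elim sum.subset_diff[OF \<open>K \<subseteq> L\<close> finite_L, of "\<lambda>v. info_fun p (x v)"]
      by (simp add: local_info_diff_def sum_subtractf)
  qed
qed

lemma integrable_local_info_diff:
  assumes "finite B"
  shows "integrable \<mu> (local_info_diff n B)"
proof (rule integrable_depends_on)
  show "finite (\<Union>v\<in>B. (+) v ` box n)"
    using assms by simp
  show "depends_on (\<Union>v\<in>B. (+) v ` box n) (local_info_diff n B)"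
    by (rule depends_on_local_info_diff) auto
qed

lemma tilted_local_info_diff_nonpos:
  assumes l_pos: "0 < l" and dep: "depends_on (cube (int n) (int l - int n)) \<psi>"
    and \<psi>_le: "\<And>x. \<bar>\<psi> x\<bar> \<le> 1" and mean: "(\<integral>x. \<psi> x \<partial>\<mu>) = 0"
  shows "(\<integral>x. (1 + \<psi> x) * local_info_diff n (cube 0 (int l)) x \<partial>\<mu>) \<le> 0" (is "?e \<le> 0")
proof -
  let ?d = "CARD('d)"
  have "?e \<le> info_bound * ((real l + 2 * real n / real m) ^ ?d - real l ^ ?d)" if "0 < m" for m
  proof -
    let ?K = "cube 0 (int l * int m) :: (int^'d) set"
    let ?L = "cube (0 - int n) (int l * int m + int n) :: (int^'d) set"
    have tiling: "local_info_diff n ?K x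
        = (\<Sum>i\<in>cube 0 (int m). local_info_diff n (cube 0 (int l)) (shift (- (int l *s i)) x))" for x
      using l_pos by (simp add: local_info_diff_def sum_cube_tiling shift_def add.assoc)
    have bound: "AE x in \<mu>. local_info_diff n ?K x \<le> info_bound * real (card (?L - ?K))"
      by (rule AE_local_info_diff_le[OF finite_cube translate_box_subset_cube])
    have dep_local: "depends_on (cube (- int n) (int l + int n)) (local_info_diff n (cube 0 (int l)))"
      using depends_on_local_info_diff_cube[of 0 n "int l"] by simp
    have "real (card (cube 0 (int m) :: (int^'d) set)) * ?e \<le> info_bound * real (card (?L - ?K))"
      using l_pos bound
      by (intro tilted_tile_le[where k = "int n" and l = "int l"] dep dep_local \<psi>_le mean)
        (simp_all add: tiling)
    also have "real (card (?L - ?K)) = (real l * real m + 2 * real n) ^ ?d - (real l * real m) ^ ?d"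
      by (subst card_cube_Diff_cube) (auto simp: nat_add_distrib nat_mult_distrib add.commute)
    also have "real l * real m + 2 * real n = real m * (real l + 2 * real n / real m)"
      using that by (simp add: field_simps)
    also have "info_bound * ((real m * (real l + 2 * real n / real m)) ^ ?d - (real l * real m) ^ ?d)
        = real m ^ ?d * (info_bound * ((real l + 2 * real n / real m) ^ ?d - real l ^ ?d))"
      by (simp add: power_mult_distrib right_diff_distrib mult_ac)
    finally show ?thesis
      using that by (simp add: card_cube)
  qed
  moreover have "(\<lambda>m. info_bound * ((real l + 2 * real n / real m) ^ ?d - real l ^ ?d))
      \<longlonglongrightarrow> info_bound * ((real l + 0) ^ ?d - real l ^ ?d)"
    by (intro tendsto_intros lim_const_over_n)
  ultimately show ?thesis
    by (intro LIMSEQ_le_const[where X = "\<lambda>m. info_bound * ((real l + 2 * real n / real m) ^ ?d - real l ^ ?d)"])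
      (auto intro!: exI[of _ 1])
qed

end

subsection \<open>The information difference under equal entropy\<close>

locale equal_entropy_homomorphism = iid_homomorphism p q \<phi>
  for p :: "'a::finite pmf" and q :: "'b::finite pmf"
    and \<phi> :: "(int^'d \<Rightarrow> 'a) \<Rightarrow> (int^'d \<Rightarrow> 'b)" +
  assumes entropy_eq: "entropy_pv p = entropy_pv q"
begin

definition info_diff :: "(int^'d) set \<Rightarrow> (int^'d \<Rightarrow> 'a) \<Rightarrow> real" where
  "info_diff B x = (\<Sum>v\<in>B. info_fun q (\<phi> x v) - info_fun p (x v))"

definition info_std_sum :: real where
  "info_std_sum = sqrt (measure_pmf.variance p (info_fun p)) + sqrt (measure_pmf.variance q (info_fun q))"

lemma info_diff_eq_centred_sum:
  "info_diff B x = centred_sum q (info_fun q) B (\<phi> x) - centred_sum p (info_fun p) B x"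
  by (simp add: info_diff_def centred_sum_def expectation_info_fun entropy_eq sum_subtractf)

lemma integrable_centred_sum_phi:
  "finite B \<Longrightarrow> integrable \<mu> (\<lambda>x. centred_sum q (info_fun q) B (\<phi> x))"
  by (intro integrable_phi integrable_centred_sum)

lemma integrable_info_diff: "finite B \<Longrightarrow> integrable \<mu> (info_diff B)"
  unfolding info_diff_eq_centred_sum[abs_def]
  by (intro Bochner_Integration.integrable_diff integrable_centred_sum_phi integrable_centred_sum)

lemma expectation_info_diff:
  assumes "finite B"
  shows "(\<integral>x. info_diff B x \<partial>\<mu>) = 0"
  using assms integral_phi[OF measurable_centred_sum, of q "info_fun q" B]
  by (simp add: info_diff_eq_centred_sum integrable_centred_sum_phi integrable_centred_sum
      expectation_centred_sum)

lemma expectation_abs_info_diff_le: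
  assumes "finite B"
  shows "(\<integral>x. \<bar>info_diff B x\<bar> \<partial>\<mu>) \<le> info_std_sum * sqrt (real (card B))"
proof -
  let ?S = "centred_sum p (info_fun p) B" and ?T = "centred_sum q (info_fun q) B"
  note int = integrable_centred_sum_phi[OF assms] integrable_centred_sum[OF assms, of p "info_fun p"]
  have "(\<integral>x. \<bar>info_diff B x\<bar> \<partial>\<mu>) \<le> (\<integral>x. \<bar>?T (\<phi> x)\<bar> + \<bar>?S x\<bar> \<partial>\<mu>)"
    using int by (intro integral_mono) (auto simp: info_diff_eq_centred_sum)
  also have "\<dots> = (\<integral>y. \<bar>?T y\<bar> \<partial>iid_measure q) + (\<integral>x. \<bar>?S x\<bar> \<partial>\<mu>)"
    using int integral_phi[of "\<lambda>y. \<bar>?T y\<bar>"] by simp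
  also have "\<dots> \<le> info_std_sum * sqrt (real (card B))"
    using expectation_abs_centred_sum_le[OF assms, of q "info_fun q"]
      expectation_abs_centred_sum_le[OF assms, of p "info_fun p"]
    by (simp add: info_std_sum_def distrib_right)
  finally show ?thesis .
qed

lemma AE_abs_info_diff_minus_local_le:
  assumes "finite B"
  shows "AE x in \<mu>. \<bar>info_diff B x - local_info_diff n B x\<bar>
    \<le> (\<Sum>v\<in>B. info_bound * indicator {y. \<not> determined n y} (shift (- v) x))"
proof -
  have "AE x in \<mu>. \<forall>v\<in>B. determined n (shift (- v) x) \<longrightarrow> \<phi> x v = code n (shift (- v) x)"
    using assms AE_phi_eq_code by (intro AE_finite_allI)
  then show ?thesis
  proof eventually_elim
    case (elim x)
    have "\<bar>info_fun q (\<phi> x v) - local_info n (shift (- v) x)\<bar>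
        \<le> info_bound * indicator {y. \<not> determined n y} (shift (- v) x)" if "v \<in> B" for v
      using elim that info_fun_q_le by (auto simp: local_info_def abs_of_nonneg[OF info_fun_nonneg])
    then have "(\<Sum>v\<in>B. \<bar>info_fun q (\<phi> x v) - local_info n (shift (- v) x)\<bar>)
        \<le> (\<Sum>v\<in>B. info_bound * indicator {y. \<not> determined n y} (shift (- v) x))"
      by (rule sum_mono)
    moreover have "info_diff B x - local_info_diff n B x
        = (\<Sum>v\<in>B. info_fun q (\<phi> x v) - local_info n (shift (- v) x))"
      by (simp add: info_diff_def local_info_diff_def sum_subtractf[symmetric])
    ultimately show ?case
      using sum_abs[of "\<lambda>v. info_fun q (\<phi> x v) - local_info n (shift (- v) x)" B] by linarith
  qed
qed

lemma expectation_abs_info_diff_minus_local_le: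
  assumes "finite B"
  shows "(\<integral>x. \<bar>info_diff B x - local_info_diff n B x\<bar> \<partial>\<mu>)
    \<le> info_bound * real (card B) * undetermined_prob n"
proof -
  let ?U = "{x. \<not> determined n x}"
  have sets_U: "?U \<in> sets \<mu>"
    by (rule sets_depends_on[OF finite_box depends_on_compose[OF depends_on_determined]])
  have int: "integrable \<mu> (\<lambda>x. indicator ?U (shift (- v) x) :: real)" for v
    by (rule iid.integrable_const_bound[of _ 1], simp)
      (rule measurable_compose[OF measurable_shift_iid borel_measurable_indicator[OF sets_U]])
  have "(\<integral>x. \<bar>info_diff B x - local_info_diff n B x\<bar> \<partial>\<mu>)
      \<le> (\<integral>x. (\<Sum>v\<in>B. info_bound * indicator ?U (shift (- v) x)) \<partial>\<mu>)"
    by (intro integral_mono_AE AE_abs_info_diff_minus_local_le integrable_abs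
        Bochner_Integration.integrable_diff Bochner_Integration.integrable_sum
        integrable_info_diff integrable_local_info_diff integrable_mult_right int assms)
  also have "\<dots> = (\<Sum>v\<in>B. info_bound * (\<integral>x. indicator ?U (shift (- v) x) \<partial>\<mu>))"
    using int by simp
  also have "\<dots> = info_bound * real (card B) * undetermined_prob n"
    using sets_U by (simp add: integral_shift_iid undetermined_prob_def)
  finally show ?thesis .
qed

lemma integral_mult_info_diff_le:
  assumes l_pos: "0 < l" and dep: "depends_on (cube (int n) (int l - int n)) \<psi>"
    and \<psi>_le: "\<And>x. \<bar>\<psi> x\<bar> \<le> 1" and mean: "(\<integral>x. \<psi> x \<partial>\<mu>) = 0"
  defines "K \<equiv> cube 0 (int l)"
  shows "(\<integral>x. \<psi> x * info_diff K x \<partial>\<mu>)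
    \<le> 2 * info_bound * real (card K) * undetermined_prob n"
proof -
  let ?D = "info_diff K" and ?G = "local_info_diff n K"
  have finite_K: "finite K"
    by (simp add: K_def)
  note int = integrable_info_diff[OF finite_K] integrable_local_info_diff[OF finite_K, of n]
  have [measurable]: "\<psi> \<in> borel_measurable \<mu>"
    by (rule measurable_depends_on[OF finite_cube dep])
  have int_mult: "integrable \<mu> (\<lambda>x. \<psi> x * F x)" if "integrable \<mu> F" for F
    using that \<psi>_le
    by (intro Bochner_Integration.integrable_bound[OF that]) (auto simp: abs_mult mult_left_le_one_le)
  have "(\<integral>x. \<psi> x * ?D x \<partial>\<mu>) = (\<integral>x. (1 + \<psi> x) * ?D x \<partial>\<mu>)"
    using int int_mult[OF int(1)] expectation_info_diff[OF finite_K] by (simp add: distrib_right)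
  also have "\<dots> \<le> (\<integral>x. (1 + \<psi> x) * ?G x + 2 * \<bar>?D x - ?G x\<bar> \<partial>\<mu>)"
  proof (rule integral_mono)
    fix x
    have "(1 + \<psi> x) * (?D x - ?G x) \<le> (1 + \<psi> x) * \<bar>?D x - ?G x\<bar>"
      using \<psi>_le[of x] by (intro mult_left_mono) (auto simp: abs_le_iff)
    also have "\<dots> \<le> 2 * \<bar>?D x - ?G x\<bar>"
      using \<psi>_le[of x] by (intro mult_right_mono) (auto simp: abs_le_iff)
    finally show "(1 + \<psi> x) * ?D x \<le> (1 + \<psi> x) * ?G x + 2 * \<bar>?D x - ?G x\<bar>"
      by (simp add: right_diff_distrib)
  qed (use int int_mult[OF int(1)] int_mult[OF int(2)] in \<open>simp_all add: distrib_right\<close>)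
  also have "\<dots> = (\<integral>x. (1 + \<psi> x) * ?G x \<partial>\<mu>) + 2 * (\<integral>x. \<bar>?D x - ?G x\<bar> \<partial>\<mu>)"
    using int int_mult[OF int(2)] by (simp add: distrib_right)
  also have "\<dots> \<le> 0 + 2 * (info_bound * real (card K) * undetermined_prob n)"
    using tilted_local_info_diff_nonpos[OF l_pos dep \<psi>_le mean]
      expectation_abs_info_diff_minus_local_le[OF finite_K]
    unfolding K_def by (intro add_mono mult_left_mono) auto
  finally show ?thesis
    by simp
qed

lemma expectation_abs_info_diff_minus_inner_local_le:
  assumes "finite K" "I \<subseteq> K"
  shows "(\<integral>x. \<bar>info_diff K x - local_info_diff n I x\<bar> \<partial>\<mu>)
    \<le> info_std_sum * sqrt (real (card (K - I))) + info_bound * real (card K) * undetermined_prob n"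
proof -
  have finite_I: "finite I" and finite_shell: "finite (K - I)"
    using assms finite_subset by auto
  note int = integrable_info_diff[OF finite_I] integrable_info_diff[OF finite_shell]
    integrable_local_info_diff[OF finite_I, of n]
  have split: "info_diff K x = info_diff (K - I) x + info_diff I x" for x
    unfolding info_diff_def using assms(2,1) by (rule sum.subset_diff)
  have "(\<integral>x. \<bar>info_diff K x - local_info_diff n I x\<bar> \<partial>\<mu>)
      \<le> (\<integral>x. \<bar>info_diff (K - I) x\<bar> + \<bar>info_diff I x - local_info_diff n I x\<bar> \<partial>\<mu>)"
    using int by (intro integral_mono) (auto simp: split)
  also have "\<dots> \<le> info_std_sum * sqrt (real (card (K - I)))
      + info_bound * real (card I) * undetermined_prob n"
    using int expectation_abs_info_diff_le[OF finite_shell]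
      expectation_abs_info_diff_minus_local_le[OF finite_I, of n]
    by simp
  also have "info_bound * real (card I) * undetermined_prob n
      \<le> info_bound * real (card K) * undetermined_prob n"
    using card_mono[OF assms] info_bound_nonneg
    by (intro mult_right_mono mult_left_mono undetermined_prob_nonneg) auto
  finally show ?thesis
    by simp
qed

lemma expectation_abs_info_diff_cube_le:
  fixes l n :: nat
  assumes l_pos: "0 < l"
  defines "K \<equiv> cube 0 (int l)" and "I \<equiv> cube (2 * int n) (int l - 2 * int n)"
  shows "(\<integral>x. \<bar>info_diff K x\<bar> \<partial>\<mu>)
    \<le> 6 * info_bound * real (card K) * undetermined_prob n + 2 * info_std_sum * sqrt (real (card (K - I)))"
proof -
  let ?D = "info_diff K" and ?W = "local_info_diff n I"
  have finite_K: "finite K" and finite_I: "finite I"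
    by (simp_all add: K_def I_def)
  have "I \<subseteq> K"
    unfolding I_def K_def by (rule cube_mono) auto
  note int_W = integrable_local_info_diff[OF finite_I, of n]
  have measurable_W: "?W \<in> borel_measurable \<mu>"
    using int_W by (rule borel_measurable_integrable)
  have dep: "depends_on (cube (int n) (int l - int n)) ?W"
    using depends_on_local_info_diff_cube[of "2 * int n" n "int l - 2 * int n"] by (simp add: I_def)
  have "depends_on (cube (int n) (int l - int n)) (iid.centred_sgn p ?W)"
    unfolding iid.centred_sgn_def[abs_def]
    by (rule depends_on_compose[OF dep, where g = "\<lambda>w. (sgn w - (\<integral>x. sgn (?W x) \<partial>\<mu>)) / 2"])
  then have test: "(\<integral>x. iid.centred_sgn p ?W x * ?D x \<partial>\<mu>)
      \<le> 2 * info_bound * real (card K) * undetermined_prob n"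
    unfolding K_def
    by (rule integral_mult_info_diff_le[OF l_pos _ iid.abs_centred_sgn_le_1[OF measurable_W]
          iid.expectation_centred_sgn[OF measurable_W]])
  have "(\<integral>x. \<bar>?D x\<bar> \<partial>\<mu>)
      \<le> 2 * (\<integral>x. iid.centred_sgn p ?W x * ?D x \<partial>\<mu>) + 2 * (\<integral>x. \<bar>?D x - ?W x\<bar> \<partial>\<mu>)"
    using integrable_info_diff[OF finite_K] expectation_info_diff[OF finite_K] int_W
    by (rule iid.expectation_abs_le_centred_sgn)
  then show ?thesis
    using test expectation_abs_info_diff_minus_inner_local_le[OF finite_K \<open>I \<subseteq> K\<close>, of n] by simp
qed

subsection \<open>Comparison of the Gaussian limits\<close>

lemma cmod_char_centred_sum_diff_le:
  assumes "finite B"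
  shows "cmod (char (distr (iid_measure q) borel (centred_sum q (info_fun q) B)) t
      - char (distr \<mu> borel (centred_sum p (info_fun p) B)) t)
    \<le> \<bar>t\<bar> * (\<integral>x. \<bar>info_diff B x\<bar> \<partial>\<mu>)"
proof -
  let ?S = "centred_sum p (info_fun p) B" and ?T = "centred_sum q (info_fun q) B"
  have "distr (distr \<mu> (iid_measure q) \<phi>) borel ?T = distr \<mu> borel (?T \<circ> \<phi>)"
    by (rule distr_distr) auto
  then have "distr (iid_measure q) borel ?T = distr \<mu> borel (\<lambda>x. ?T (\<phi> x))"
    by (simp add: distr_phi comp_def)
  then show ?thesis
    using iid.cmod_char_distr_diff_le[OF integrable_centred_sum_phi[OF assms] integrable_centred_sum[OF assms]]
    by (simp add: info_diff_eq_centred_sum)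
qed

text \<open>Removing the margins \<open>2n\<close> from a cube of side \<open>(m + 4)n\<close> leaves a cube of side \<open>mn\<close>.\<close>
lemma normalised_info_diff_cube_le:
  fixes m n :: nat
  assumes n_pos: "0 < n"
  defines "B \<equiv> cube 0 (int ((m + 4) * n))" and "d \<equiv> CARD('d)"
  shows "(\<integral>x. \<bar>info_diff B x\<bar> \<partial>\<mu>) / sqrt (real (card B))
    \<le> 6 * info_bound * real (m + 4) powr (real d / 2)
        * (real n powr (real d / 2) * undetermined_prob n)
      + 2 * info_std_sum * sqrt (1 - (real m / real (m + 4)) ^ d)"
proof -
  let ?N = "real (card B)"
  let ?I = "cube (2 * int n) (int ((m + 4) * n) - 2 * int n) :: (int^'d) set"
  have card_B: "?N = (real (m + 4) * real n) ^ d"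
    by (simp add: B_def d_def card_cube nat_mult_distrib nat_add_distrib)
  have N_pos: "0 < ?N"
    unfolding card_B using n_pos by simp
  have "sqrt ?N = ((real (m + 4) * real n) powr real d) powr (1/2)"
    unfolding card_B using n_pos by (simp add: powr_half_sqrt powr_realpow)
  also have "\<dots> = real (m + 4) powr (real d / 2) * real n powr (real d / 2)"
    by (simp only: powr_powr powr_mult) simp
  finally have sqrt_N: "sqrt ?N = real (m + 4) powr (real d / 2) * real n powr (real d / 2)" .
  have "int ((m + 4) * n) - 2 * int n - 2 * int n = int (m * n)"
    by (simp add: algebra_simps)
  then have "real (card (B - ?I)) = (real (m + 4) * real n) ^ d - (real m * real n) ^ d"
    unfolding B_def d_def by (subst card_cube_Diff_cube) simp_all
  also have "\<dots> = ?N * (1 - (real m / real (m + 4)) ^ d)"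
    unfolding card_B power_mult_distrib power_divide by (simp add: right_diff_distrib)
  finally have shell: "sqrt (real (card (B - ?I))) = sqrt ?N * sqrt (1 - (real m / real (m + 4)) ^ d)"
    by (simp add: real_sqrt_mult)
  have "(\<integral>x. \<bar>info_diff B x\<bar> \<partial>\<mu>)
      \<le> 6 * info_bound * ?N * undetermined_prob n + 2 * info_std_sum * sqrt (real (card (B - ?I)))"
    unfolding B_def using n_pos by (intro expectation_abs_info_diff_cube_le) simp
  then have "(\<integral>x. \<bar>info_diff B x\<bar> \<partial>\<mu>) / sqrt ?N
      \<le> (6 * info_bound * ?N * undetermined_prob n + 2 * info_std_sum * sqrt (real (card (B - ?I)))) / sqrt ?N"
    by (rule divide_right_mono) simp
  also have "\<dots> = 6 * info_bound * sqrt ?N * undetermined_prob n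
      + 2 * info_std_sum * sqrt (1 - (real m / real (m + 4)) ^ d)"
  proof -
    have "(a * s\<^sup>2 * u + c * (s * r)) / s = a * s * u + c * r" if "0 < s" for a c r s u :: real
      using that by (simp add: add_divide_distrib power2_eq_square)
    from this[where s = "sqrt ?N" and a = "6 * info_bound" and c = "2 * info_std_sum"] show ?thesis
      unfolding shell using N_pos by (simp only: real_sqrt_gt_0_iff real_sqrt_pow2 less_imp_le)
  qed
  finally show ?thesis
    by (simp add: sqrt_N mult_ac)
qed

lemma abs_gaussian_char_diff_le:
  assumes tail: "(\<lambda>n. real n powr (real CARD('d) / 2) * undetermined_prob n) \<longlonglongrightarrow> 0"
  shows "\<bar>exp (- (measure_pmf.variance q (info_fun q) / 2))
      - exp (- (measure_pmf.variance p (info_fun p) / 2))\<bar>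
    \<le> 2 * info_std_sum * sqrt (1 - (real m / real (m + 4)) ^ CARD('d))"
    (is "\<bar>exp (- (?Vq / 2)) - exp (- (?Vp / 2))\<bar> \<le> ?r")
proof -
  let ?d = "CARD('d)"
  define B where "B n = (cube 0 (int ((m + 4) * n)) :: (int^'d) set)" for n
  let ?t = "\<lambda>n. 1 / sqrt (real (card (B n)))"
  define gap where "gap n = char (distr (iid_measure q) borel (centred_sum q (info_fun q) (B n))) (?t n)
    - char (distr \<mu> borel (centred_sum p (info_fun p) (B n))) (?t n)" for n
  let ?e = "\<lambda>n. 6 * info_bound * real (m + 4) powr (real ?d / 2)
      * (real n powr (real ?d / 2) * undetermined_prob n) + ?r"
  have "n \<le> card (B n)" for n
  proof -
    have "n ^ 1 \<le> ((m + 4) * n) ^ ?d"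
      by (cases "n = 0") (auto intro!: order_trans[OF _ self_le_power])
    then show ?thesis
      by (simp add: B_def card_cube nat_mult_distrib nat_add_distrib)
  qed
  then have card_at_top: "filterlim (\<lambda>n. card (B n)) at_top sequentially"
    by (intro filterlim_at_top_mono[OF filterlim_ident]) simp
  have "gap \<longlonglongrightarrow> of_real (exp (- (1\<^sup>2 * ?Vq / 2))) - of_real (exp (- (1\<^sup>2 * ?Vp / 2)))"
    unfolding gap_def by (intro tendsto_diff char_normalised_centred_sum_tendsto card_at_top)
  then have "(\<lambda>n. cmod (gap n)) \<longlonglongrightarrow> \<bar>exp (- (?Vq / 2)) - exp (- (?Vp / 2))\<bar>"
    by (simp only: tendsto_norm of_real_diff[symmetric] norm_of_real[symmetric, where ?'a = complex]
        power_one mult_1)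
  moreover have "?e \<longlonglongrightarrow> 6 * info_bound * real (m + 4) powr (real ?d / 2) * 0 + ?r"
    by (intro tendsto_intros tail)
  moreover have "cmod (gap n) \<le> ?e n" if "1 \<le> n" for n
    using cmod_char_centred_sum_diff_le[of "B n" "?t n"] normalised_info_diff_cube_le[of n m] that
    by (simp add: gap_def B_def)
  ultimately show ?thesis
    by (intro LIMSEQ_le[of "\<lambda>n. cmod (gap n)" _ ?e]) auto
qed

lemma variance_info_eq:
  assumes tail: "(\<lambda>n. real n powr (real CARD('d) / 2) * undetermined_prob n) \<longlonglongrightarrow> 0"
  shows "measure_pmf.variance p (info_fun p) = measure_pmf.variance q (info_fun q)"
    (is "?Vp = ?Vq")
proof -
  have "(\<lambda>m. real m / real (m + 4)) \<longlonglongrightarrow> 1"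
    by real_asymp
  then have "(\<lambda>m. 2 * info_std_sum * sqrt (1 - (real m / real (m + 4)) ^ CARD('d)))
      \<longlonglongrightarrow> 2 * info_std_sum * sqrt (1 - 1 ^ CARD('d))"
    by (intro tendsto_intros)
  then have "\<bar>exp (- (?Vq / 2)) - exp (- (?Vp / 2))\<bar> \<le> 2 * info_std_sum * sqrt (1 - 1 ^ CARD('d))"
    by (rule LIMSEQ_le_const) (use abs_gaussian_char_diff_le[OF tail] in blast)
  then show ?thesis
    by simp
qed

end

theorem theorem1:
  fixes p :: "'a::finite pmf" and q :: "'b::finite pmf"
    and \<phi> :: "(int^'d \<Rightarrow> 'a) \<Rightarrow> (int^'d \<Rightarrow> 'b)"
  assumes "entropy_pv p = entropy_pv q"
    and "is_homomorphism (iid_measure p) (iid_measure q) \<phi>"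
    and "finitary (iid_measure p) \<phi>"
    and "integrable (iid_measure p)
           (\<lambda>x. real (the_enat (coding_radius (iid_measure p) \<phi> x)) powr (real CARD('d) / 2))"
  shows "prob_space.variance (iid_measure p :: (int^'d \<Rightarrow> 'a) measure) (\<lambda>x. info_fun p (x 0))
       = prob_space.variance (iid_measure q :: (int^'d \<Rightarrow> 'b) measure) (\<lambda>y. info_fun q (y 0))"
proof -
  interpret equal_entropy_homomorphism p q \<phi>
    using assms(1,2) by unfold_locales
  have "(\<lambda>n. real n powr (real CARD('d) / 2) * undetermined_prob n) \<longlonglongrightarrow> 0"
    using assms(3,4) by (intro powr_mult_undetermined_prob_tendsto_0) auto
  then show ?thesis
    unfolding variance_component_iid by (rule variance_info_eq)
qed

end
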